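(* Let $\mathcal{X}$ be a Polish space and let $H_0$ versus $H_1$ be a hypothesis testing problem over $\mathcal{X}$ whose ambient space $H_0\cup H_1$ (with the subspace topology inherited from the weak topology) is a Baire space. Then the following two conditions are equivalent: (1) The two hypotheses $H_0$ and $H_1$ are everywhere intertwined. (2) There exists no finite-precision test that achieves both (i) dense consistency in each hypothesis and (ii) nonmeager consistency.
   Context: $\mathcal{X}$ is a Polish space with Borel $\sigma$-algebra $\mathscr{B}(\mathcal{X})$. The set of all probability measures on $\mathscr{B}(\mathcal{X})$ carries the weak topology (the topology of weak convergence of measures), and every subset of it carries the subspace topology. A hypothesis is a set of probability measures on $\mathscr{B}(\mathcal{X})$; a hypothesis testing problem consists of two disjoint hypotheses $H_0$ and $H_1$. The ambient topological space is $H_0\cup H_1$ with the subspace topology. A test $\varphi$ is a sequence of measurable functions $\varphi_n:\mathcal{X}^n\to\{0,1,\texttt{?}\}$, $n=1,2,\ldots$; write $\{\varphi_n=i\}=\{x\in\mathcal{X}^n:\varphi_n(x)=i\}$. The test $\varphi$ is finite-precision iff for every $n$ and every $i\in\{0,1\}$ the set $\{\varphi_n=i\}$ is open in $\mathcal{X}^n$ (product topology). For $\mathbb{P}\in H_i$, $\varphi$ is consistent at $\mathbb{P}$ iff $\mathbb{P}^n\{\varphi_n=i\}\to 1$ as $n\to\infty$, where $\mathbb{P}^n$ is the $n$-fold product measure of $\mathbb{P}$; $\varphi$ is consistent on a set $S$ iff it is consistent at every element of $S$. Meager, nonmeager (= not meager) and comeager (= complement meager) have their standard meanings. A Baire space is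 a space in which every comeager set is dense (equivalently, no nonempty open set is meager). Dense consistency in each hypothesis: for each $i\in\{0,1\}$, $\varphi$ is consistent on some dense subset of $H_i$ (with its own subspace topology). Nonmeager consistency: the set of measures in $H_0\cup H_1$ at which $\varphi$ is consistent is nonmeager in $H_0\cup H_1$. $H_0$ and $H_1$ are intertwined in a nonempty open subset $O$ of $H_0\cup H_1$ iff both $H_0$ and $H_1$ are dense in $O$ (i.e. $H_0\cap O$ and $H_1\cap O$ are both dense in $O$). They are everywhere intertwined iff they are intertwined in every nonempty open subset of $H_0\cup H_1$. *)

theory Defs
  imports "HOL-Probability.Probability"
begin

subsection \<open>Category notions for abstract topologies\<close>

definition dense_in :: "'a topology \<Rightarrow> 'a set \<Rightarrow> bool" where
  "dense_in X S \<longleftrightarrow> S \<subseteq> topspace X \<and> X closure_of S = topspace X"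

definition nowhere_dense_in :: "'a topology \<Rightarrow> 'a set \<Rightarrow> bool" where
  "nowhere_dense_in X S \<longleftrightarrow> S \<subseteq> topspace X \<and> X interior_of (X closure_of S) = {}"

definition meager_in :: "'a topology \<Rightarrow> 'a set \<Rightarrow> bool" where
  "meager_in X S \<longleftrightarrow> (\<exists>\<F>. countable \<F> \<and> (\<forall>A\<in>\<F>. nowhere_dense_in X A) \<and> S = \<Union>\<F>)"

definition comeager_in :: "'a topology \<Rightarrow> 'a set \<Rightarrow> bool" where
  "comeager_in X S \<longleftrightarrow> S \<subseteq> topspace X \<and> meager_in X (topspace X - S)"

definition Baire_space :: "'a topology \<Rightarrow> bool" where
  "Baire_space X \<longleftrightarrow> (\<forall>S. comeager_in X S \<longrightarrow> dense_in X S)"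

subsection \<open>The weak topology on Borel probability measures\<close>

text \<open>The coarsest topology on the set of all Borel probability measures making
  \<open>\<mu> \<mapsto> \<integral> f d\<mu>\<close> continuous for every bounded continuous \<open>f\<close>.\<close>

definition weak_topology :: "'a::topological_space measure topology" where
  "weak_topology = topology_generated_by
     {{\<mu> \<in> space (prob_algebra borel). (\<integral>x. f x \<partial>\<mu>) \<in> U} | (f :: 'a \<Rightarrow> real) U.
        continuous_on UNIV f \<and> bounded (range f) \<and> open U}"

lemma topspace_weak_topology [simp]:
  "topspace weak_topology = space (prob_algebra borel)"
proof -
  have "space (prob_algebra borel) \<in>
     {{\<mu> \<in> space (prob_algebra borel). (\<integral>x. f x \<partial>\<mu>) \<in> U} | (f :: 'a::topological_space \<Rightarrow> real) U.
        continuous_on UNIV f \<and> bounded (range f) \<and> open U}"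
    by (rule CollectI, rule exI[of _ "\<lambda>_. 0"], rule exI[of _ UNIV]) auto
  then show ?thesis
    unfolding weak_topology_def topology_generated_by_topspace by blast
qed

lemma limitin_weak_topology:
  fixes \<mu> :: "'a::topological_space measure"
  shows "limitin weak_topology \<nu> \<mu> F \<longleftrightarrow>
    \<mu> \<in> space (prob_algebra borel) \<and>
    (\<forall>\<^sub>F i in F. \<nu> i \<in> space (prob_algebra borel)) \<and>
    (\<forall>f :: 'a \<Rightarrow> real. continuous_on UNIV f \<and> bounded (range f) \<longrightarrow>
       ((\<lambda>i. \<integral>x. f x \<partial>\<nu> i) \<longlongrightarrow> (\<integral>x. f x \<partial>\<mu>)) F)" (is "?L \<longleftrightarrow> ?R")
proof
  let ?B = "\<lambda>(f :: 'a \<Rightarrow> real) U. {\<mu> \<in> space (prob_algebra borel). (\<integral>x. f x \<partial>\<mu>) \<in> U}"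
  assume L: ?L
  then have \<mu>: "\<mu> \<in> space (prob_algebra borel)"
    by (auto simp: limitin_def)
  have ev: "\<forall>\<^sub>F i in F. \<nu> i \<in> W" if "openin weak_topology W" "\<mu> \<in> W" for W
    using L that by (auto simp: limitin_def)
  have "\<forall>\<^sub>F i in F. \<nu> i \<in> space (prob_algebra borel)"
    using ev[OF openin_topspace] \<mu> by simp
  moreover have "((\<lambda>i. \<integral>x. f x \<partial>\<nu> i) \<longlongrightarrow> (\<integral>x. f x \<partial>\<mu>)) F"
    if f: "continuous_on UNIV f" "bounded (range f)" for f :: "'a \<Rightarrow> real"
  proof (rule topological_tendstoI)
    fix U :: "real set" assume U: "open U" "(\<integral>x. f x \<partial>\<mu>) \<in> U"
    have "openin weak_topology (?B f U)"
      unfolding weak_topology_def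
      by (rule topology_generated_by_Basis) (use f U in blast)
    from ev[OF this] show "\<forall>\<^sub>F i in F. (\<integral>x. f x \<partial>\<nu> i) \<in> U"
      using \<mu> U by (auto elim: eventually_mono)
  qed
  ultimately show ?R using \<mu> by blast
next
  assume R: ?R
  let ?S = "{{\<mu> \<in> space (prob_algebra borel). (\<integral>x. f x \<partial>\<mu>) \<in> U} | (f :: 'a \<Rightarrow> real) U.
        continuous_on UNIV f \<and> bounded (range f) \<and> open U}"
  have "\<mu> \<in> W \<longrightarrow> (\<forall>\<^sub>F i in F. \<nu> i \<in> W)" if "generate_topology_on ?S W" for W
    using that
  proof induction
    case (Int a b)
    then show ?case by (auto intro: eventually_conj)
  next
    case (UN K)
    then show ?case by (blast intro: eventually_mono)
  next
    case (Basis s)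
    then obtain f U where fU: "s = {\<mu> \<in> space (prob_algebra borel). (\<integral>x. f x \<partial>\<mu>) \<in> U}"
      "continuous_on UNIV (f :: 'a \<Rightarrow> real)" "bounded (range f)" "open U" by blast
    show ?case
    proof
      assume "\<mu> \<in> s"
      then have "\<forall>\<^sub>F i in F. (\<integral>x. f x \<partial>\<nu> i) \<in> U"
        using R fU by (auto intro: topological_tendstoD)
      moreover have "\<forall>\<^sub>F i in F. \<nu> i \<in> space (prob_algebra borel)" using R by blast
      ultimately show "\<forall>\<^sub>F i in F. \<nu> i \<in> s"
        unfolding fU(1) by eventually_elim auto
    qed
  qed simp
  then have "\<mu> \<in> W \<longrightarrow> (\<forall>\<^sub>F i in F. \<nu> i \<in> W)" if "openin weak_topology W" for W
    using that unfolding weak_topology_def openin_topology_generated_by_iff by blast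
  then show ?L
    using R unfolding limitin_def topspace_weak_topology by blast
qed

subsection \<open>Hypotheses and tests\<close>

definition hypothesis :: "'a::topological_space measure set \<Rightarrow> bool" where
  "hypothesis H \<longleftrightarrow> H \<subseteq> space (prob_algebra borel)"

definition ambient_space ::
  "'a::topological_space measure set \<Rightarrow> 'a measure set \<Rightarrow> 'a measure topology" where
  "ambient_space H0 H1 = subtopology weak_topology (H0 \<union> H1)"

datatype verdict = Accept0 | Accept1 | Undecided

text \<open>The power \<open>X\<^sup>n\<close> is \<open>{..<n} \<rightarrow>\<^sub>E UNIV\<close>; sample size \<open>n = 0\<close> is never constrained.\<close>

definition verdict_set :: "(nat \<Rightarrow> (nat \<Rightarrow> 'a) \<Rightarrow> verdict) \<Rightarrow> nat \<Rightarrow> verdict \<Rightarrow> (nat \<Rightarrow> 'a) set" where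
  "verdict_set \<phi> n v = {x \<in> {..<n} \<rightarrow>\<^sub>E UNIV. \<phi> n x = v}"

definition is_test :: "(nat \<Rightarrow> (nat \<Rightarrow> 'a::topological_space) \<Rightarrow> verdict) \<Rightarrow> bool" where
  "is_test \<phi> \<longleftrightarrow>
     (\<forall>n\<ge>1. \<phi> n \<in> (\<Pi>\<^sub>M i\<in>{..<n}. borel) \<rightarrow>\<^sub>M count_space UNIV)"

definition finite_precision :: "(nat \<Rightarrow> (nat \<Rightarrow> 'a::topological_space) \<Rightarrow> verdict) \<Rightarrow> bool" where
  "finite_precision \<phi> \<longleftrightarrow>
     (\<forall>n\<ge>1. \<forall>v\<in>{Accept0, Accept1}.
        openin (product_topology (\<lambda>_. euclidean) {..<n}) (verdict_set \<phi> n v))"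

text \<open>A test is consistent at \<open>P \<in> H0\<close> if \<open>converges_to_verdict \<phi> Accept0 P\<close>, and at
  \<open>P \<in> H1\<close> if \<open>converges_to_verdict \<phi> Accept1 P\<close>.\<close>

definition converges_to_verdict ::
  "(nat \<Rightarrow> (nat \<Rightarrow> 'a) \<Rightarrow> verdict) \<Rightarrow> verdict \<Rightarrow> 'a measure \<Rightarrow> bool" where
  "converges_to_verdict \<phi> v P \<longleftrightarrow>
     (\<lambda>n. measure (\<Pi>\<^sub>M i\<in>{..<n}. P) (verdict_set \<phi> n v)) \<longlonglongrightarrow> 1"

definition consistency_set ::
  "'a measure set \<Rightarrow> 'a measure set \<Rightarrow> (nat \<Rightarrow> (nat \<Rightarrow> 'a) \<Rightarrow> verdict) \<Rightarrow> 'a measure set" where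
  "consistency_set H0 H1 \<phi> =
     {P \<in> H0. converges_to_verdict \<phi> Accept0 P} \<union> {P \<in> H1. converges_to_verdict \<phi> Accept1 P}"

definition densely_consistent_in_each ::
  "'a::topological_space measure set \<Rightarrow> 'a measure set \<Rightarrow>
     (nat \<Rightarrow> (nat \<Rightarrow> 'a) \<Rightarrow> verdict) \<Rightarrow> bool" where
  "densely_consistent_in_each H0 H1 \<phi> \<longleftrightarrow>
     (\<exists>D. dense_in (subtopology weak_topology H0) D \<and> D \<subseteq> consistency_set H0 H1 \<phi>) \<and>
     (\<exists>D. dense_in (subtopology weak_topology H1) D \<and> D \<subseteq> consistency_set H0 H1 \<phi>)"

definition nonmeagerly_consistent ::
  "'a::topological_space measure set \<Rightarrow> 'a measure set \<Rightarrow>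
     (nat \<Rightarrow> (nat \<Rightarrow> 'a) \<Rightarrow> verdict) \<Rightarrow> bool" where
  "nonmeagerly_consistent H0 H1 \<phi> \<longleftrightarrow>
     \<not> meager_in (ambient_space H0 H1) (consistency_set H0 H1 \<phi>)"

subsection \<open>Intertwined hypotheses\<close>

definition intertwined_in ::
  "'a::topological_space measure set \<Rightarrow> 'a measure set \<Rightarrow> 'a measure set \<Rightarrow> bool" where
  "intertwined_in H0 H1 U \<longleftrightarrow>
     dense_in (subtopology (ambient_space H0 H1) U) (H0 \<inter> U) \<and>
     dense_in (subtopology (ambient_space H0 H1) U) (H1 \<inter> U)"

definition everywhere_intertwined ::
  "'a::topological_space measure set \<Rightarrow> 'a measure set \<Rightarrow> bool" where
  "everywhere_intertwined H0 H1 \<longleftrightarrow>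
     (\<forall>U. openin (ambient_space H0 H1) U \<and> U \<noteq> {} \<longrightarrow> intertwined_in H0 H1 U)"

end

theory Submission
  imports Defs
begin

text \<open>
  Write \<open>P\<^sup>n\<close> for the law of \<open>n\<close> independent samples from \<open>P\<close>.

  Suppose the hypotheses are everywhere intertwined, and a finite-precision test is consistent
  on dense subsets \<open>D0\<close> of \<open>H0\<close> and \<open>D1\<close> of \<open>H1\<close>. For an open set \<open>U\<close> of samples the probability \<open>P\<^sup>n(U)\<close>
  is lower semicontinuous in \<open>P\<close> (\<open>openin_weak_power_measure_greater\<close>). So the set of \<open>P\<close> at which
  the verdict \<open>i\<close> has probability above one half at some sample size beyond \<open>N\<close> is open, and it is
  dense because it contains \<open>Di\<close>, which is dense in \<open>Hi\<close> and hence in the whole space. A consistent test gives the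
  wrong verdict with probability below one half from some sample size on, so each \<open>P\<close> at which the
  test is consistent misses one of these countably many dense open sets. The consistency set is
  therefore meager (\<open>intertwined_imp_consistency_set_meager\<close>).

  Conversely, if the hypotheses are not everywhere intertwined, some nonempty open subset \<open>V\<close> of
  the ambient space is disjoint from one of them, say from \<open>H1\<close>. The test then has to tell apart,
  on one side, a nonempty open part \<open>G\<close> of \<open>V\<close> together with a countable dense subset of \<open>H0\<close> and,
  on the other side, a countable dense subset of \<open>H1\<close>. It is consistent on \<open>G\<close>, which is nonmeager
  by the Baire property. Such tests are put together from elementary ones in a small calculus of
  sets that can be told apart, \<open>asymptotically_separated\<close>: comparing a sample mean of a bounded
  continuous \<open>f\<close> with a threshold separates the laws with \<open>\<integral> f\<close> above it from those with \<open>\<integral> f\<close>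
  below it; separation is stable under finite unions; hence for each neighbourhood of a measure a
  smaller one is separated from the complement of the given one
  (\<open>asymptotically_separated_nhd\<close>), disjoint finite sets are separated, and by a diagonal argument
  so are disjoint countable sets (\<open>asymptotically_separated_countable\<close>). The countable dense subsets
  exist because the weak topology is hereditarily separable
  (\<open>weak_topology_hereditarily_separable\<close>).
\<close>

section \<open>Probability measures, their powers and bounded continuous functions\<close>

abbreviation borel_probs :: "'a::topological_space measure set" where
  "borel_probs \<equiv> space (prob_algebra borel)"

abbreviation power_measure :: "'a measure \<Rightarrow> nat \<Rightarrow> (nat \<Rightarrow> 'a) measure" where
  "power_measure P n \<equiv> (\<Pi>\<^sub>M i\<in>{..<n}. P)"

abbreviation power_top :: "nat \<Rightarrow> (nat \<Rightarrow> 'a::topological_space) topology" where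
  "power_top n \<equiv> product_topology (\<lambda>_. euclidean) {..<n}"

abbreviation bounded_continuous :: "('a::topological_space \<Rightarrow> real) \<Rightarrow> bool" where
  "bounded_continuous f \<equiv> continuous_on UNIV f \<and> bounded (range f)"

lemma borel_probsD:
  assumes "P \<in> borel_probs"
  shows "prob_space P" "sets P = sets borel" "space P = UNIV"
  using assms sets_eq_imp_space_eq[of P borel] by (auto simp: space_prob_algebra)

lemma prob_space_power_measure:
  assumes "P \<in> borel_probs"
  shows "prob_space (power_measure P n)"
  using assms by (intro prob_space_PiM) (auto dest: borel_probsD)

lemma sets_power_measure:
  assumes "P \<in> borel_probs"
  shows "sets (power_measure P n) = sets (\<Pi>\<^sub>M i\<in>{..<n}. borel)"
  using assms by (intro sets_PiM_cong) (auto dest: borel_probsD)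

lemma space_power_measure:
  assumes "P \<in> borel_probs"
  shows "space (power_measure P n) = ({..<n} \<rightarrow>\<^sub>E UNIV)"
  using borel_probsD[OF assms] by (simp add: space_PiM)

lemma bounded_continuous_minus:
  assumes "bounded_continuous f"
  shows "bounded_continuous (\<lambda>x. - f x)"
  using assms by (auto intro: continuous_on_minus simp: bounded_iff)

lemma integrable_bounded_continuous:
  assumes "P \<in> borel_probs" "bounded_continuous f"
  shows "integrable P f"
proof -
  interpret prob_space P using assms(1) by (rule borel_probsD)
  obtain B where "\<And>x. norm (f x) \<le> B" using assms(2) by (auto simp: bounded_iff)
  moreover have "f \<in> borel_measurable P"
    using assms borel_measurable_continuous_onI[of f]
    by (simp add: measurable_cong_sets[OF borel_probsD(2)[OF assms(1)] refl])
  ultimately show ?thesis by (intro integrable_const_bound[of _ B]) auto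
qed

lemma openin_weak_integral:
  assumes "bounded_continuous f" "open U"
  shows "openin weak_topology {P \<in> borel_probs. (\<integral>x. f x \<partial>P) \<in> U}"
  unfolding weak_topology_def by (rule topology_generated_by_Basis) (use assms in blast)

lemma continuous_map_weak_integral:
  assumes "bounded_continuous f"
  shows "continuous_map weak_topology euclideanreal (\<lambda>P. \<integral>x. f x \<partial>P)"
  unfolding continuous_map_def using openin_weak_integral[OF assms] by auto

text \<open>The approximants are truncated multiples of the distance to the complement, \<open>min 1 (k d(x, -U))\<close>.\<close>
lemma open_indicator_approximation:
  fixes U :: "'a::metric_space set"
  assumes "open U"
  obtains f :: "nat \<Rightarrow> 'a \<Rightarrow> real" where "\<forall>k. bounded_continuous (f k)"
    "\<forall>k x. 0 \<le> f k x \<and> f k x \<le> indicator U x" "\<forall>x. (\<lambda>k. f k x) \<longlonglongrightarrow> indicator U x"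
proof (cases "U = UNIV")
  case True
  then show ?thesis by (intro that[of "\<lambda>_ _. 1"]) auto
next
  case False
  then have ne: "- U \<noteq> {}" by auto
  define f :: "nat \<Rightarrow> 'a \<Rightarrow> real" where "f k x = min 1 (real k * infdist x (- U))" for k x
  have "bounded_continuous (f k)" for k
  proof
    show "continuous_on UNIV (f k)" unfolding f_def by (intro continuous_intros)
    have "0 \<le> f k x \<and> f k x \<le> 1" for x by (simp add: f_def infdist_nonneg)
    then show "bounded (range (f k))" unfolding bounded_iff by (intro exI[of _ 1]) auto
  qed
  moreover have bd: "0 \<le> f k x \<and> f k x \<le> indicator U x" for k x
    unfolding f_def by (cases "x \<in> U") (auto simp: infdist_nonneg)
  moreover have "(\<lambda>k. f k x) \<longlonglongrightarrow> indicator U x" for x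
  proof (cases "x \<in> U")
    case True
    then have pos: "infdist x (- U) > 0"
      using assms ne in_closed_iff_infdist_zero[of "- U" x] infdist_nonneg[of x "- U"]
      by (auto simp: less_le)
    obtain K :: nat where K: "1 < real K * infdist x (- U)" using reals_Archimedean3[OF pos] by blast
    have "f k x = 1" if "k \<ge> K" for k
    proof -
      have "real K * infdist x (- U) \<le> real k * infdist x (- U)"
        using that by (intro mult_right_mono) (auto simp: infdist_nonneg)
      then show ?thesis using K by (simp add: f_def)
    qed
    then show ?thesis using True by (intro tendsto_eventually) (auto simp: eventually_sequentially)
  next
    case False
    then show ?thesis using bd[of _ x] by (intro tendsto_eventually) (simp add: order_antisym)
  qed
  ultimately show ?thesis by (intro that[of f]) simp_all
qed

text \<open>Second countability turns an open subset of the power into a sequence of boxes. Nonemptiness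
  is required because for \<open>n = 0\<close> every box is the whole one-point power.\<close>
lemma open_power_eq_UN_boxes:
  fixes U :: "(nat \<Rightarrow> 'a::second_countable_topology) set"
  assumes U: "openin (power_top n) U" and ne: "U \<noteq> {}"
  obtains b :: "nat \<Rightarrow> nat \<Rightarrow> 'a set" where "\<forall>j. \<forall>i<n. open (b j i)" "U = (\<Union>j. Pi\<^sub>E {..<n} (b j))"
proof -
  obtain \<B> :: "'a set set" where B: "countable \<B>" "topological_basis \<B>"
    using ex_countable_basis by blast
  define C where "C = {b \<in> {..<n} \<rightarrow>\<^sub>E \<B>. Pi\<^sub>E {..<n} b \<subseteq> U}"
  have cnt: "countable C"
    unfolding C_def by (rule countable_subset[OF _ countable_PiE[of "{..<n}" "\<lambda>_. \<B>"]]) (auto simp: B)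
  have ex: "\<exists>b\<in>C. x \<in> Pi\<^sub>E {..<n} b" if x: "x \<in> U" for x
  proof -
    obtain V where V: "\<forall>i\<in>{..<n}. openin euclidean (V i)" "x \<in> Pi\<^sub>E {..<n} V" "Pi\<^sub>E {..<n} V \<subseteq> U"
      using U[unfolded openin_product_topology_alt, rule_format, OF x] by blast
    then have V_open: "open (V i)" if "i < n" for i using V(1) that by simp
    have "\<exists>W\<in>\<B>. x i \<in> W \<and> W \<subseteq> V i" if "i < n" for i
      using topological_basisE[OF B(2) V_open[OF that]] V(2) that by (metis PiE_mem lessThan_iff)
    then obtain W where W: "\<And>i. i < n \<Longrightarrow> W i \<in> \<B> \<and> x i \<in> W i \<and> W i \<subseteq> V i" by metis
    have "Pi\<^sub>E {..<n} (restrict W {..<n}) \<subseteq> Pi\<^sub>E {..<n} V"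
      using W by (intro PiE_mono) auto
    moreover have "x \<in> Pi\<^sub>E {..<n} (restrict W {..<n})"
      using W V(2) by (auto simp: PiE_iff)
    ultimately show ?thesis using W V(3) by (intro bexI[of _ "restrict W {..<n}"]) (auto simp: C_def)
  qed
  have "C \<noteq> {}" using ex ne by blast
  then have r: "range (from_nat_into C) = C" using cnt by (rule range_from_nat_into)
  have "\<forall>j. \<forall>i<n. open (from_nat_into C j i)"
  proof (intro allI impI)
    fix i j assume i: "i < n"
    have "from_nat_into C j \<in> C" using r by blast
    then have "from_nat_into C j i \<in> \<B>" using i by (auto simp: C_def)
    then show "open (from_nat_into C j i)" using B(2) by (rule topological_basis_open[rotated])
  qed
  moreover have "U = (\<Union>j. Pi\<^sub>E {..<n} (from_nat_into C j))"
  proof -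
    have "U = (\<Union>b\<in>C. Pi\<^sub>E {..<n} b)" using ex by (auto simp: C_def)
    also have "\<dots> = (\<Union>b\<in>range (from_nat_into C). Pi\<^sub>E {..<n} b)" by (simp only: r)
    finally show ?thesis by simp
  qed
  ultimately show ?thesis by (rule that)
qed

lemma open_power_measurable:
  fixes U :: "(nat \<Rightarrow> 'a::second_countable_topology) set"
  assumes "openin (power_top n) U"
  shows "U \<in> sets (\<Pi>\<^sub>M i\<in>{..<n}. borel)"
proof (cases "U = {}")
  case False
  obtain b :: "nat \<Rightarrow> nat \<Rightarrow> 'a set"
    where b: "\<forall>j. \<forall>i<n. open (b j i)" "U = (\<Union>j. Pi\<^sub>E {..<n} (b j))"
    by (rule open_power_eq_UN_boxes[OF assms False])
  show ?thesis unfolding b(2)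
    by (intro sets.countable_UN' sets_PiM_I_finite) (auto simp: b(1))
qed simp

section \<open>Lower semicontinuity of power measures of open sets\<close>

text \<open>Linear combinations of products \<open>g\<^sub>0(x\<^sub>0) \<cdots> g\<^sub>n\<^sub>-\<^sub>1(x\<^sub>n\<^sub>-\<^sub>1)\<close>. Their integrals against the \<open>n\<close>-th power
  of \<open>P\<close> are polynomials in integrals against \<open>P\<close>, which makes them weakly continuous in \<open>P\<close> without
  any appeal to weak convergence on the power space.\<close>
inductive tensor_poly :: "nat \<Rightarrow> ((nat \<Rightarrow> 'a::topological_space) \<Rightarrow> real) \<Rightarrow> bool" for n where
  elementary: "(\<And>i. i < n \<Longrightarrow> bounded_continuous (g i)) \<Longrightarrow>
    tensor_poly n (\<lambda>x. a * (\<Prod>i<n. g i (x i)))"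
| add: "tensor_poly n h \<Longrightarrow> tensor_poly n k \<Longrightarrow> tensor_poly n (\<lambda>x. h x + k x)"

lemma tensor_poly_const: "tensor_poly n (\<lambda>_. a)"
  using tensor_poly.elementary[of n "\<lambda>_ _. 1" a] by simp

lemma bounded_continuous_mult:
  assumes "bounded_continuous f" "bounded_continuous g"
  shows "bounded_continuous (\<lambda>x. f x * g x)"
proof
  show "continuous_on UNIV (\<lambda>x. f x * g x)" using assms by (auto intro: continuous_on_mult)
  obtain a b where "\<And>x. norm (f x) \<le> a" "\<And>x. norm (g x) \<le> b"
    using assms by (auto simp: bounded_iff)
  then have "norm (f x * g x) \<le> a * b" for x
    unfolding norm_mult by (meson mult_mono norm_ge_zero order_trans)
  then show "bounded (range (\<lambda>x. f x * g x))" unfolding bounded_iff by blast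
qed

lemma tensor_poly_mult:
  assumes "tensor_poly n h" "tensor_poly n k"
  shows "tensor_poly n (\<lambda>x. h x * k x)"
  using assms
proof (induction h arbitrary: k)
  case h: (elementary g a)
  from h.prems show ?case
  proof (induction k)
    case (elementary g' a')
    have "tensor_poly n (\<lambda>x. (a * a') * (\<Prod>i<n. (\<lambda>y. g i y * g' i y) (x i)))"
      by (rule tensor_poly.elementary, rule bounded_continuous_mult) (auto simp: h elementary)
    then show ?case by (simp add: prod.distrib mult_ac)
  next
    case (add k k')
    from tensor_poly.add[OF add.IH] show ?case by (simp add: algebra_simps)
  qed
next
  case (add h h')
  from tensor_poly.add[OF add.IH, OF add.prems add.prems] show ?case by (simp add: algebra_simps)
qed

lemma tensor_poly_compl:
  assumes "tensor_poly n h"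
  shows "tensor_poly n (\<lambda>x. 1 - h x)"
  using tensor_poly.add[OF tensor_poly_const tensor_poly_mult[OF tensor_poly_const assms], of 1 "-1"]
  by simp

lemma tensor_poly_prod:
  assumes "\<And>j. j \<in> J \<Longrightarrow> tensor_poly n (h j)"
  shows "tensor_poly n (\<lambda>x. \<Prod>j\<in>J. h j x)"
  using assms
  by (induction J rule: infinite_finite_induct) (auto intro: tensor_poly_const tensor_poly_mult)

text \<open>Fubini turns the integral of an elementary product into a product of integrals of bounded
  continuous functions, each of which is weakly continuous by definition.\<close>
lemma tensor_poly_integral:
  assumes "tensor_poly n h"
  shows "(\<forall>P\<in>borel_probs. integrable (power_measure P n) h) \<and>
    continuous_map weak_topology euclideanreal (\<lambda>P. \<integral>x. h x \<partial>power_measure P n)"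
  using assms
proof induction
  case (elementary g a)
  have int: "integrable (power_measure P n) (\<lambda>x. \<Prod>i<n. g i (x i))"
    and eq: "(\<integral>x. (\<Prod>i<n. g i (x i)) \<partial>power_measure P n) = (\<Prod>i<n. \<integral>x. g i x \<partial>P)"
    if P: "P \<in> borel_probs" for P
  proof -
    interpret P: prob_space P using P by (rule borel_probsD)
    interpret product_sigma_finite "\<lambda>_. P" ..
    show "integrable (power_measure P n) (\<lambda>x. \<Prod>i<n. g i (x i))"
      by (intro product_integrable_prod) (auto intro!: integrable_bounded_continuous P elementary)
    show "(\<integral>x. (\<Prod>i<n. g i (x i)) \<partial>power_measure P n) = (\<Prod>i<n. \<integral>x. g i x \<partial>P)"
      by (intro product_integral_prod) (auto intro!: integrable_bounded_continuous P elementary)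
  qed
  have "continuous_map weak_topology euclideanreal (\<lambda>P. a * (\<Prod>i<n. \<integral>x. g i x \<partial>P))"
    by (intro continuous_map_real_mult continuous_map_prod continuous_map_weak_integral)
       (auto simp: elementary)
  then have "continuous_map weak_topology euclideanreal
      (\<lambda>P. \<integral>x. a * (\<Prod>i<n. g i (x i)) \<partial>power_measure P n)"
    by (rule continuous_map_eq) (simp add: eq)
  then show ?case using int by auto
next
  case (add h k)
  have "continuous_map weak_topology euclideanreal
      (\<lambda>P. (\<integral>x. h x \<partial>power_measure P n) + (\<integral>x. k x \<partial>power_measure P n))"
    using add by (intro continuous_map_add) auto
  then have "continuous_map weak_topology euclideanreal
      (\<lambda>P. \<integral>x. h x + k x \<partial>power_measure P n)"
    by (rule continuous_map_eq) (use add.IH in auto)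
  then show ?case using add by auto
qed

text \<open>An open set is a union of boxes \<open>\<Prod>\<^sub>i b\<^sub>j\<^sub>i\<close>. The indicator of each side \<open>b\<^sub>j\<^sub>i\<close> is a limit of bounded
  continuous functions from below, and finite unions of boxes are handled by
  \<open>1 - \<Prod>\<^sub>j (1 - \<Prod>\<^sub>i f\<^sub>j\<^sub>i(x\<^sub>i))\<close>, which unlike a maximum is a polynomial in the \<open>f\<^sub>j\<^sub>i\<close>.\<close>
lemma open_power_tensor_approximation:
  fixes U :: "(nat \<Rightarrow> 'a::{metric_space, second_countable_topology}) set"
  assumes U: "openin (power_top n) U" and ne: "U \<noteq> {}"
  obtains h where "\<forall>k::nat. tensor_poly n (h k)"
    "\<forall>k. \<forall>x\<in>{..<n} \<rightarrow>\<^sub>E UNIV. 0 \<le> h k x \<and> h k x \<le> indicator U x"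
    "\<forall>x\<in>{..<n} \<rightarrow>\<^sub>E UNIV. (\<lambda>k. h k x) \<longlonglongrightarrow> indicator U x"
proof -
  obtain b :: "nat \<Rightarrow> nat \<Rightarrow> 'a set"
    where b: "\<forall>j. \<forall>i<n. open (b j i)" "U = (\<Union>j. Pi\<^sub>E {..<n} (b j))"
    by (rule open_power_eq_UN_boxes[OF assms])
  define approximates where "approximates g V \<longleftrightarrow> (\<forall>k. bounded_continuous (g k)) \<and>
    (\<forall>k x. 0 \<le> g k x \<and> g k x \<le> indicator V x) \<and> (\<forall>x. (\<lambda>k. g k x) \<longlonglongrightarrow> indicator V x)"
    for g :: "nat \<Rightarrow> 'a \<Rightarrow> real" and V
  define f where "f j i = (SOME g. approximates g (b j i))" for j i
  have "approximates (f j i) (b j i)" if "i < n" for i j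
  proof -
    have "open (b j i)" using b(1) that by simp
    then obtain g where "approximates g (b j i)"
      unfolding approximates_def by (rule open_indicator_approximation) blast
    then show ?thesis unfolding f_def by (rule someI[of "\<lambda>g. approximates g (b j i)"])
  qed
  then have f: "\<And>i j k. i < n \<Longrightarrow> bounded_continuous (f j i k)"
     "\<And>i j k x. i < n \<Longrightarrow> 0 \<le> f j i k x \<and> f j i k x \<le> indicator (b j i) x"
     "\<And>i j x. i < n \<Longrightarrow> (\<lambda>k. f j i k x) \<longlonglongrightarrow> indicator (b j i) x"
    unfolding approximates_def by simp_all
  define p where "p j k x = (\<Prod>i<n. f j i k (x i))" for j k :: nat and x :: "nat \<Rightarrow> 'a"
  \<comment> \<open>Both the number of boxes and the precision of the approximation of their sides grow with \<open>k\<close>.\<close>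
  define h where "h k x = 1 - (\<Prod>j<k. 1 - p j k x)" for k :: nat and x :: "nat \<Rightarrow> 'a"
  have p01: "0 \<le> p j k x" "p j k x \<le> 1" for j k x
  proof -
    have "f j i k y \<le> 1" if "i < n" for i y
    proof -
      have "indicator (b j i) y \<le> (1::real)" by (rule indicator_le_1)
      then show ?thesis using f(2)[OF that, of j k y] by linarith
    qed
    then show "0 \<le> p j k x" "p j k x \<le> 1"
      unfolding p_def by (auto intro!: prod_nonneg prod_le_1 simp: f(2))
  qed
  have "tensor_poly n (p j k)" for j k
    using tensor_poly.elementary[of n "\<lambda>i. f j i k" 1] f(1) by (simp add: p_def [abs_def])
  then have tens: "tensor_poly n (h k)" for k
    unfolding h_def [abs_def] by (intro tensor_poly_compl tensor_poly_prod)
  have h01: "0 \<le> h k x" "h k x \<le> 1" for k x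
    unfolding h_def by (auto intro!: prod_nonneg prod_le_1 simp: p01)
  have out: "h k x = 0" if x: "x \<in> {..<n} \<rightarrow>\<^sub>E UNIV" "x \<notin> U" for k x
  proof -
    have "p j k x = 0" for j
    proof -
      have "x \<notin> Pi\<^sub>E {..<n} (b j)" using x b(2) by blast
      then obtain i where i: "i < n" "x i \<notin> b j i" using x(1) by (auto simp: PiE_iff)
      then have "f j i k (x i) = 0" using f(2)[OF i(1), of j k "x i"] by simp
      then show ?thesis using i(1) unfolding p_def by (intro prod_zero) auto
    qed
    then show ?thesis by (simp add: h_def)
  qed
  have "\<forall>k. \<forall>x\<in>{..<n} \<rightarrow>\<^sub>E UNIV. 0 \<le> h k x \<and> h k x \<le> indicator U x"
    using h01 out by (simp add: indicator_def)
  moreover have "(\<lambda>k. h k x) \<longlonglongrightarrow> indicator U x" if x: "x \<in> {..<n} \<rightarrow>\<^sub>E UNIV" for x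
  proof (cases "x \<in> U")
    case False
    then show ?thesis using out x by simp
  next
    case True
    then obtain j where j: "x \<in> Pi\<^sub>E {..<n} (b j)" using b(2) by blast
    have "(\<lambda>k. p j k x) \<longlonglongrightarrow> (\<Prod>i<n. indicator (b j i) (x i))"
      unfolding p_def by (intro tendsto_prod f(3)) auto
    also have "(\<Prod>i<n. indicator (b j i) (x i)) = (1::real)"
    proof (intro prod.neutral ballI)
      fix i assume "i \<in> {..<n}"
      with j have "x i \<in> b j i" by (rule PiE_mem)
      then show "indicator (b j i) (x i) = (1::real)" by (rule indicator_simps)
    qed
    finally have lim: "(\<lambda>k. p j k x) \<longlonglongrightarrow> 1" .
    have "p j k x \<le> h k x" if "k > j" for k
    proof -
      have "(\<Prod>l<k. 1 - p l k x) = (1 - p j k x) * (\<Prod>l\<in>{..<k} - {j}. 1 - p l k x)"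
        using that by (subst prod.remove[of _ j]) auto
      also have "\<dots> \<le> (1 - p j k x) * 1"
        using p01 by (intro mult_left_mono prod_le_1) auto
      finally show ?thesis by (simp add: h_def)
    qed
    then have "(\<lambda>k. h k x) \<longlonglongrightarrow> 1"
      using h01 by (intro tendsto_sandwich[OF _ _ lim tendsto_const])
        (simp_all add: eventually_sequentially Suc_le_eq exI[of _ "Suc j"])
    then show ?thesis using True by simp
  qed
  ultimately show ?thesis using tens by (intro that[of h]) simp_all
qed

text \<open>By the approximation from below, \<open>P\<^sup>n(U)\<close> exceeds \<open>c\<close> exactly when one of countably many weakly
  continuous functions of \<open>P\<close> does.\<close>
lemma openin_weak_power_measure_greater:
  fixes U :: "(nat \<Rightarrow> 'a::{metric_space, second_countable_topology}) set"
  assumes U: "openin (power_top n) U"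
  shows "openin weak_topology {P \<in> borel_probs. measure (power_measure P n) U > c}"
proof (cases "U = {}")
  case True
  then show ?thesis using openin_topspace[of weak_topology] by (cases "c < 0") auto
next
  case False
  obtain h where h': "\<forall>k::nat. tensor_poly n (h k)"
    "\<forall>k. \<forall>x\<in>{..<n} \<rightarrow>\<^sub>E UNIV. 0 \<le> h k x \<and> h k x \<le> indicator U x"
    "\<forall>x\<in>{..<n} \<rightarrow>\<^sub>E UNIV. (\<lambda>k. h k x) \<longlonglongrightarrow> indicator U x"
    by (rule open_power_tensor_approximation[OF U False])
  note h = h'(1)[rule_format] h'(2)[rule_format] h'(3)[rule_format]
  have iff: "measure (power_measure P n) U > c \<longleftrightarrow> (\<exists>k. (\<integral>x. h k x \<partial>power_measure P n) > c)"
    if P: "P \<in> borel_probs" for P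
  proof -
    interpret prob_space "power_measure P n" using P by (rule prob_space_power_measure)
    have Um [measurable]: "U \<in> sets (power_measure P n)"
      using open_power_measurable[OF U] by (simp add: sets_power_measure[OF P])
    have int: "integrable (power_measure P n) (h k)" for k
      using tensor_poly_integral[OF h(1)] P by blast
    have intU: "integrable (power_measure P n) (indicator U :: _ \<Rightarrow> real)"
      by (simp add: integrable_indicator_iff emeasure_eq_measure)
    have eq: "(\<integral>x. indicator U x \<partial>power_measure P n) = measure (power_measure P n) U"
      using sets.sets_into_space[OF Um] by (simp add: Int_absorb2)
    have le: "(\<integral>x. h k x \<partial>power_measure P n) \<le> measure (power_measure P n) U" for k
      unfolding eq[symmetric]
      by (intro integral_mono int intU) (use h(2) space_power_measure[OF P] in auto)
    have "(\<lambda>k. \<integral>x. h k x \<partial>power_measure P n) \<longlonglongrightarrow> (\<integral>x. indicator U x \<partial>power_measure P n)"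
    proof (rule integral_dominated_convergence[where w = "\<lambda>_. 1"])
      show "AE x in power_measure P n. (\<lambda>k. h k x) \<longlonglongrightarrow> indicator U x"
        using h(3) space_power_measure[OF P] by (intro AE_I2) auto
      show "AE x in power_measure P n. norm (h k x) \<le> 1" for k
      proof (rule AE_I2)
        fix x assume "x \<in> space (power_measure P n)"
        then have "0 \<le> h k x \<and> h k x \<le> indicator U x"
          using h(2) space_power_measure[OF P] by simp
        moreover have "indicator U x \<le> (1::real)" by (rule indicator_le_1)
        ultimately have "0 \<le> h k x \<and> h k x \<le> 1" by linarith
        then show "norm (h k x) \<le> 1" by simp
      qed
    qed (use int in auto)
    then have lim: "(\<lambda>k. \<integral>x. h k x \<partial>power_measure P n) \<longlonglongrightarrow> measure (power_measure P n) U"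
      by (simp only: eq)
    show ?thesis
    proof
      assume "measure (power_measure P n) U > c"
      from order_tendstoD(1)[OF lim this] show "\<exists>k. (\<integral>x. h k x \<partial>power_measure P n) > c"
        by (auto simp: eventually_sequentially)
    qed (use le in \<open>auto intro: less_le_trans\<close>)
  qed
  have "openin weak_topology {P \<in> topspace weak_topology. (\<integral>x. h k x \<partial>power_measure P n) \<in> {c<..}}" for k
    using tensor_poly_integral[OF h(1)] by (intro openin_continuous_map_preimage[of _ euclideanreal]) auto
  then have "openin weak_topology (\<Union>k. {P \<in> topspace weak_topology. (\<integral>x. h k x \<partial>power_measure P n) \<in> {c<..}})"
    by blast
  also have "(\<Union>k. {P \<in> topspace weak_topology. (\<integral>x. h k x \<partial>power_measure P n) \<in> {c<..}}) =
      {P \<in> borel_probs. measure (power_measure P n) U > c}"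
    using iff by auto
  finally show ?thesis .
qed

section \<open>Sample means\<close>

lemma indep_vars_power_measure:
  assumes P: "P \<in> borel_probs" and n: "n > 0"
  shows "prob_space.indep_vars (power_measure P n) (\<lambda>_. P) (\<lambda>i x. x i) {..<n}"
proof -
  interpret prob_space "power_measure P n" using P by (rule prob_space_power_measure)
  have "distr (power_measure P n) (power_measure P n) (\<lambda>x. \<lambda>i\<in>{..<n}. x i) =
      distr (power_measure P n) (power_measure P n) (\<lambda>x. x)"
    by (intro distr_cong) (auto simp: space_PiM PiE_def extensional_restrict)
  also have "\<dots> = power_measure P n" by (rule distr_id)
  also have "\<dots> = (\<Pi>\<^sub>M i\<in>{..<n}. distr (power_measure P n) P (\<lambda>x. x i))"
    using borel_probsD(1)[OF P] by (intro PiM_cong refl distr_PiM_component[symmetric]) auto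
  finally have eq: "distr (power_measure P n) (power_measure P n) (\<lambda>x. \<lambda>i\<in>{..<n}. x i) =
      (\<Pi>\<^sub>M i\<in>{..<n}. distr (power_measure P n) P (\<lambda>x. x i))" .
  show ?thesis using n by (subst indep_vars_iff_distr_eq_PiM') (auto simp: eq)
qed

text \<open>Hoeffding's inequality for the independent variables \<open>f(x\<^sub>i)\<close>, whose values lie in \<open>[-B, B]\<close>.\<close>
lemma measure_sample_mean_le:
  assumes P: "P \<in> borel_probs" and f: "continuous_on UNIV f" "\<And>x. \<bar>f x\<bar> \<le> B" and B: "B > 0"
    and n: "n > 0" and c: "c \<le> (\<integral>x. f x \<partial>P)"
  shows "measure (power_measure P n) {x \<in> {..<n} \<rightarrow>\<^sub>E UNIV. (\<Sum>i<n. f (x i)) \<le> real n * c} \<le>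
    exp (- real n * ((\<integral>x. f x \<partial>P) - c)\<^sup>2 / (2 * B\<^sup>2))"
proof -
  interpret P: prob_space P using P by (rule borel_probsD)
  interpret prob_space "power_measure P n" using P by (rule prob_space_power_measure)
  let ?m = "\<integral>x. f x \<partial>P"
  have fm [measurable]: "f \<in> borel_measurable P"
    using borel_measurable_continuous_onI[OF f(1)]
    by (simp add: measurable_cong_sets[OF borel_probsD(2)[OF P] refl])
  have mean: "expectation (\<lambda>x. f (x i)) = ?m" if "i \<in> {..<n}" for i
  proof -
    have "?m = (\<integral>x. f x \<partial>distr (power_measure P n) P (\<lambda>x. x i))"
      using P.prob_space_axioms that by (subst distr_PiM_component) auto
    also have "\<dots> = expectation (\<lambda>x. f (x i))"
      using that by (intro integral_distr) auto
    finally show ?thesis ..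
  qed
  interpret H: Hoeffding_ineq "power_measure P n" "{..<n}" "\<lambda>i x. f (x i)" "\<lambda>_. - B" "\<lambda>_. B"
    "real n * ?m"
  proof unfold_locales
    show "indep_vars (\<lambda>_. borel) (\<lambda>i x. f (x i)) {..<n}"
      by (rule indep_vars_compose2[OF indep_vars_power_measure[OF P n]]) auto
    show "AE x in power_measure P n. f (x i) \<in> {- B..B}" for i
      using f(2) by (auto simp: abs_le_iff minus_le_iff)
    show "real n * ?m \<equiv> \<Sum>i<n. expectation (\<lambda>x. f (x i))"
      by (rule eq_reflection) (simp add: mean)
  qed simp
  have "prob {x \<in> space (power_measure P n). (\<Sum>i<n. f (x i)) \<le> real n * ?m - real n * (?m - c)} \<le>
      exp (- 2 * (real n * (?m - c))\<^sup>2 / (\<Sum>i<n. (B - - B)\<^sup>2))"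
    using n B c by (intro H.Hoeffding_ineq_le) auto
  also have "- 2 * (real n * (?m - c))\<^sup>2 / (\<Sum>i<n. (B - - B)\<^sup>2) = - real n * (?m - c)\<^sup>2 / (2 * B\<^sup>2)"
    using n B by (simp add: field_simps power2_eq_square)
  also have "real n * ?m - real n * (?m - c) = real n * c" by (simp add: algebra_simps)
  finally show ?thesis by (simp add: space_power_measure[OF P])
qed

definition sample_sum_greater :: "('a \<Rightarrow> real) \<Rightarrow> real \<Rightarrow> nat \<Rightarrow> (nat \<Rightarrow> 'a) set" where
  "sample_sum_greater f c n = {x \<in> {..<n} \<rightarrow>\<^sub>E UNIV. real n * c < (\<Sum>i<n. f (x i))}"

lemma openin_sample_sum_greater:
  assumes "continuous_on UNIV f"
  shows "openin (power_top n) (sample_sum_greater f c n)"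
proof -
  have "continuous_map (power_top n) euclideanreal (\<lambda>x. f (x i))" if "i \<in> {..<n}" for i
  proof -
    have "continuous_map (power_top n) euclidean (\<lambda>x. x i)"
      using that by (intro continuous_map_product_projection)
    moreover have "continuous_map euclidean euclideanreal f" using assms by simp
    ultimately have "continuous_map (power_top n) euclideanreal (f \<circ> (\<lambda>x. x i))"
      by (rule continuous_map_compose)
    then show ?thesis by (simp add: o_def)
  qed
  then have "continuous_map (power_top n) euclideanreal (\<lambda>x. \<Sum>i<n. f (x i))"
    by (intro continuous_map_sum) auto
  then have "openin (power_top n) {x \<in> topspace (power_top n). (\<Sum>i<n. f (x i)) \<in> {real n * c<..}}"
    by (rule openin_continuous_map_preimage) simp
  then show ?thesis by (simp add: sample_sum_greater_def topspace_product_topology)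
qed

lemma power_measure_sample_sum_greater_tendsto_1:
  fixes f :: "'a::second_countable_topology \<Rightarrow> real"
  assumes P: "P \<in> borel_probs" and f: "bounded_continuous f" and c: "c < (\<integral>x. f x \<partial>P)"
  shows "(\<lambda>n. measure (power_measure P n) (sample_sum_greater f c n)) \<longlonglongrightarrow> 1"
proof -
  obtain B where B: "B > 0" "\<And>x. \<bar>f x\<bar> \<le> B" using f by (auto simp: bounded_pos)
  define r where "r = ((\<integral>x. f x \<partial>P) - c)\<^sup>2 / (2 * B\<^sup>2)"
  have r: "r > 0" using B c by (simp add: r_def)
  have lower: "1 - exp (- r) ^ n \<le> measure (power_measure P n) (sample_sum_greater f c n)" if "n > 0" for n
  proof -
    interpret prob_space "power_measure P n" using P by (rule prob_space_power_measure)
    have "sample_sum_greater f c n \<in> sets (power_measure P n)"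
      unfolding sets_power_measure[OF P]
      using f by (intro open_power_measurable openin_sample_sum_greater) simp
    then have "prob (space (power_measure P n) - sample_sum_greater f c n) =
        1 - prob (sample_sum_greater f c n)" by (rule prob_compl)
    also have "space (power_measure P n) - sample_sum_greater f c n =
        {x \<in> {..<n} \<rightarrow>\<^sub>E UNIV. (\<Sum>i<n. f (x i)) \<le> real n * c}"
      unfolding space_power_measure[OF P] sample_sum_greater_def
      by (rule set_eqI, simp only: Diff_iff mem_Collect_eq not_less de_Morgan_conj, blast)
    finally have "1 - prob (sample_sum_greater f c n) =
        prob {x \<in> {..<n} \<rightarrow>\<^sub>E UNIV. (\<Sum>i<n. f (x i)) \<le> real n * c}" by (rule sym)
    also have "\<dots> \<le> exp (- real n * ((\<integral>x. f x \<partial>P) - c)\<^sup>2 / (2 * B\<^sup>2))"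
      using f c by (intro measure_sample_mean_le[OF P _ B(2,1) that]) simp_all
    also have "- real n * ((\<integral>x. f x \<partial>P) - c)\<^sup>2 / (2 * B\<^sup>2) = real n * - r"
      by (simp add: r_def)
    also have "exp (real n * - r) = exp (- r) ^ n" by (rule exp_of_nat_mult)
    finally show ?thesis by simp
  qed
  have lim: "(\<lambda>n. 1 - exp (- r) ^ n) \<longlonglongrightarrow> 1 - 0"
    using r by (intro tendsto_diff tendsto_const LIMSEQ_realpow_zero) auto
  show ?thesis
  proof (rule tendsto_sandwich[OF _ _ lim[unfolded diff_zero] tendsto_const])
    show "\<forall>\<^sub>F n in sequentially. 1 - exp (- r) ^ n \<le> measure (power_measure P n) (sample_sum_greater f c n)"
      using eventually_gt_at_top[of 0] by (rule eventually_mono) (rule lower)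
    show "\<forall>\<^sub>F n in sequentially. measure (power_measure P n) (sample_sum_greater f c n) \<le> 1"
      using prob_space.prob_le_1[OF prob_space_power_measure[OF P]] by (intro always_eventually allI)
  qed
qed

section \<open>Asymptotically separated sets of measures\<close>

text \<open>The disjoint open sets \<open>A n\<close> and \<open>B n\<close> are the acceptance regions of a finite-precision test that
  is consistent for \<open>S\<close> against \<open>T\<close>. As pairs of sets rather than verdict functions, tests are
  combined by intersections and unions of their regions.\<close>
definition separates_along ::
  "(nat \<Rightarrow> (nat \<Rightarrow> 'a::topological_space) set) \<Rightarrow> (nat \<Rightarrow> (nat \<Rightarrow> 'a) set) \<Rightarrow>
    'a measure set \<Rightarrow> 'a measure set \<Rightarrow> bool" where
  "separates_along A B S T \<longleftrightarrow> S \<subseteq> borel_probs \<and> T \<subseteq> borel_probs \<and>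
     (\<forall>n. openin (power_top n) (A n)) \<and> (\<forall>n. openin (power_top n) (B n)) \<and> (\<forall>n. A n \<inter> B n = {}) \<and>
     (\<forall>P\<in>S. (\<lambda>n. measure (power_measure P n) (A n)) \<longlonglongrightarrow> 1) \<and>
     (\<forall>P\<in>T. (\<lambda>n. measure (power_measure P n) (B n)) \<longlonglongrightarrow> 1)"

definition asymptotically_separated ::
  "'a::topological_space measure set \<Rightarrow> 'a measure set \<Rightarrow> bool" where
  "asymptotically_separated S T \<longleftrightarrow> (\<exists>A B. separates_along A B S T)"

lemma asymptotically_separatedI:
  assumes "S \<subseteq> borel_probs" "T \<subseteq> borel_probs"
    "\<And>n. openin (power_top n) (A n)" "\<And>n. openin (power_top n) (B n)" "\<And>n. A n \<inter> B n = {}"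
    "\<And>P. P \<in> S \<Longrightarrow> (\<lambda>n. measure (power_measure P n) (A n)) \<longlonglongrightarrow> 1"
    "\<And>P. P \<in> T \<Longrightarrow> (\<lambda>n. measure (power_measure P n) (B n)) \<longlonglongrightarrow> 1"
  shows "asymptotically_separated S T"
proof -
  have "separates_along A B S T" unfolding separates_along_def using assms by (intro conjI allI ballI)
  then show ?thesis unfolding asymptotically_separated_def by blast
qed

lemma separates_alongD:
  assumes "separates_along A B S T"
  shows "S \<subseteq> borel_probs" "T \<subseteq> borel_probs"
    "openin (power_top n) (A n)" "openin (power_top n) (B n)" "A n \<inter> B n = {}"
    "P \<in> S \<Longrightarrow> (\<lambda>n. measure (power_measure P n) (A n)) \<longlonglongrightarrow> 1"
    "P \<in> T \<Longrightarrow> (\<lambda>n. measure (power_measure P n) (B n)) \<longlonglongrightarrow> 1"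
  using assms unfolding separates_along_def by (elim conjE; simp)+

lemma asymptotically_separated_sym:
  assumes "asymptotically_separated S T"
  shows "asymptotically_separated T S"
proof -
  obtain A B where "separates_along A B S T"
    using assms unfolding asymptotically_separated_def by blast
  note AB = separates_alongD[OF this]
  show ?thesis by (rule asymptotically_separatedI[OF AB(2,1,4,3) _ AB(7,6)]) (use AB(5) in blast)
qed

lemma asymptotically_separated_mono:
  assumes "asymptotically_separated S T" "S' \<subseteq> S" "T' \<subseteq> T"
  shows "asymptotically_separated S' T'"
proof -
  obtain A B where "separates_along A B S T"
    using assms(1) unfolding asymptotically_separated_def by blast
  note AB = separates_alongD[OF this]
  show ?thesis
  proof (rule asymptotically_separatedI[OF _ _ AB(3,4,5)])
    show "(\<lambda>n. measure (power_measure P n) (A n)) \<longlonglongrightarrow> 1" if "P \<in> S'" for P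
      using that assms(2) by (intro AB(6)) blast
    show "(\<lambda>n. measure (power_measure P n) (B n)) \<longlonglongrightarrow> 1" if "P \<in> T'" for P
      using that assms(3) by (intro AB(7)) blast
  qed (use AB(1,2) assms(2,3) in blast)+
qed

lemma asymptotically_separated_empty:
  assumes "S \<subseteq> borel_probs"
  shows "asymptotically_separated S {}"
proof (rule asymptotically_separatedI[of _ _ "\<lambda>n. topspace (power_top n)" "\<lambda>_. {}"])
  fix P assume "P \<in> S"
  then have P: "P \<in> borel_probs" using assms by blast
  then show "(\<lambda>n. measure (power_measure P n) (topspace (power_top n))) \<longlonglongrightarrow> 1"
    using prob_space.prob_space[OF prob_space_power_measure[OF P]]
    by (simp add: space_power_measure[OF P] topspace_product_topology)
next
  show "openin (power_top n) (topspace (power_top n))" for n by (rule openin_topspace)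
qed (use assms in auto)

text \<open>Accept the first hypothesis when both tests do, and the second when at least one test does.\<close>
lemma asymptotically_separated_Un:
  fixes S T T' :: "'a::second_countable_topology measure set"
  assumes "asymptotically_separated S T" "asymptotically_separated S T'"
  shows "asymptotically_separated S (T \<union> T')"
proof -
  obtain A B where "separates_along A B S T"
    using assms(1) unfolding asymptotically_separated_def by blast
  note AB = separates_alongD[OF this]
  obtain A' B' where "separates_along A' B' S T'"
    using assms(2) unfolding asymptotically_separated_def by blast
  note AB' = separates_alongD[OF this]
  have meas: "U \<in> sets (power_measure P n)" if "openin (power_top n) U" "P \<in> borel_probs"
    for U :: "(nat \<Rightarrow> 'a) set" and P n
    using open_power_measurable[OF that(1)] by (simp add: sets_power_measure[OF that(2)])
  have Un: "(\<lambda>n. measure (power_measure P n) (C n \<union> D n)) \<longlonglongrightarrow> 1"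
    if P: "P \<in> borel_probs" and o: "\<And>n. openin (power_top n) (C n)" "\<And>n. openin (power_top n) (D n)"
      and lim: "(\<lambda>n. measure (power_measure P n) (C n)) \<longlonglongrightarrow> 1"
    for P and C D :: "nat \<Rightarrow> (nat \<Rightarrow> 'a) set"
  proof (rule tendsto_sandwich[OF _ _ lim tendsto_const])
    have "measure (power_measure P n) (C n) \<le> measure (power_measure P n) (C n \<union> D n)" for n
      using finite_measure.finite_measure_mono[OF prob_space.finite_measure[OF prob_space_power_measure[OF P]]]
        meas[OF _ P] o by (simp add: openin_Un)
    then show "\<forall>\<^sub>F n in sequentially. measure (power_measure P n) (C n) \<le> measure (power_measure P n) (C n \<union> D n)"
      by simp
    show "\<forall>\<^sub>F n in sequentially. measure (power_measure P n) (C n \<union> D n) \<le> 1"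
      using prob_space.prob_le_1[OF prob_space_power_measure[OF P]] by simp
  qed
  have Int: "(\<lambda>n. measure (power_measure P n) (A n \<inter> A' n)) \<longlonglongrightarrow> 1" if PS: "P \<in> S" for P
  proof -
    have P: "P \<in> borel_probs" using AB(1) PS by blast
    have ge: "measure (power_measure P n) (A n) + measure (power_measure P n) (A' n) - 1 \<le>
        measure (power_measure P n) (A n \<inter> A' n)" for n
    proof -
      interpret prob_space "power_measure P n" using P by (rule prob_space_power_measure)
      have "A n \<in> events" "A' n \<in> events" by (rule meas[OF AB(3) P], rule meas[OF AB'(3) P])
      then have "prob (A n \<union> A' n) = prob (A n) + prob (A' n) - prob (A n \<inter> A' n)"
        by (intro measure_Un3) (simp_all add: fmeasurable_eq_sets)
      moreover have "prob (A n \<union> A' n) \<le> 1" by simp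
      ultimately show ?thesis by linarith
    qed
    have lim: "(\<lambda>n. measure (power_measure P n) (A n) + measure (power_measure P n) (A' n) - 1) \<longlonglongrightarrow> 1 + 1 - 1"
      using AB(6)[OF PS] AB'(6)[OF PS] by (intro tendsto_diff tendsto_add tendsto_const)
    show ?thesis
      by (rule tendsto_sandwich[OF always_eventually always_eventually _ tendsto_const])
        (use ge prob_space.prob_le_1[OF prob_space_power_measure[OF P]] lim in simp_all)
  qed
  have Un1: "(\<lambda>n. measure (power_measure P n) (B n \<union> B' n)) \<longlonglongrightarrow> 1" if P: "P \<in> T \<union> T'" for P
  proof (cases "P \<in> T")
    case True
    then have "P \<in> borel_probs" using AB(2) by blast
    then show ?thesis using AB(4) AB'(4) AB(7)[OF True] by (rule Un)
  next
    case False
    with P have T': "P \<in> T'" by blast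
    then have "P \<in> borel_probs" using AB'(2) by blast
    then have "(\<lambda>n. measure (power_measure P n) (B' n \<union> B n)) \<longlonglongrightarrow> 1"
      using AB'(4) AB(4) AB'(7)[OF T'] by (rule Un)
    then show ?thesis by (simp add: Un_commute)
  qed
  show ?thesis
  proof (rule asymptotically_separatedI[OF _ _ _ _ _ Int Un1])
    show "openin (power_top n) (A n \<inter> A' n)" for n using AB(3) AB'(3) by (rule openin_Int)
    show "openin (power_top n) (B n \<union> B' n)" for n using AB(4) AB'(4) by (rule openin_Un)
    show "(A n \<inter> A' n) \<inter> (B n \<union> B' n) = {}" for n using AB(5)[of n] AB'(5)[of n] by blast
  qed (use AB(1,2) AB'(2) in auto)
qed

lemma asymptotically_separated_Un_left:
  fixes S S' T :: "'a::second_countable_topology measure set"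
  assumes "asymptotically_separated S T" "asymptotically_separated S' T"
  shows "asymptotically_separated (S \<union> S') T"
  using assms by (meson asymptotically_separated_Un asymptotically_separated_sym)

text \<open>The weak law of large numbers: the sample mean of \<open>f\<close> ends up on the same side of \<open>c\<close> as its
  expectation. Strict inequalities on both sides make the two acceptance regions open.\<close>
lemma asymptotically_separated_integral:
  fixes f :: "'a::second_countable_topology \<Rightarrow> real"
  assumes f: "bounded_continuous f"
  shows "asymptotically_separated {P \<in> borel_probs. c < (\<integral>x. f x \<partial>P)} {P \<in> borel_probs. (\<integral>x. f x \<partial>P) < c}"
proof (rule asymptotically_separatedI[of _ _ "sample_sum_greater f c" "sample_sum_greater (\<lambda>x. - f x) (- c)"])
  have f': "bounded_continuous (\<lambda>x. - f x)"
    using f by (rule bounded_continuous_minus)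
  show "openin (power_top n) (sample_sum_greater f c n)" for n
    using f by (intro openin_sample_sum_greater) simp
  show "openin (power_top n) (sample_sum_greater (\<lambda>x. - f x) (- c) n)" for n
    using f' by (intro openin_sample_sum_greater) simp
  show "sample_sum_greater f c n \<inter> sample_sum_greater (\<lambda>x. - f x) (- c) n = {}" for n
  proof (rule ccontr)
    assume "sample_sum_greater f c n \<inter> sample_sum_greater (\<lambda>x. - f x) (- c) n \<noteq> {}"
    then obtain x where "real n * c < (\<Sum>i<n. f (x i))" "real n * - c < (\<Sum>i<n. - f (x i))"
      unfolding sample_sum_greater_def by blast
    then show False by (simp add: sum_negf)
  qed
  show "(\<lambda>n. measure (power_measure P n) (sample_sum_greater f c n)) \<longlonglongrightarrow> 1"
    if "P \<in> {P \<in> borel_probs. c < (\<integral>x. f x \<partial>P)}" for P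
    using that f by (intro power_measure_sample_sum_greater_tendsto_1) auto
  show "(\<lambda>n. measure (power_measure P n) (sample_sum_greater (\<lambda>x. - f x) (- c) n)) \<longlonglongrightarrow> 1"
    if "P \<in> {P \<in> borel_probs. (\<integral>x. f x \<partial>P) < c}" for P
    using that f' by (intro power_measure_sample_sum_greater_tendsto_1) auto
qed auto

text \<open>A statistical form of regularity of the weak topology. For a subbasic neighbourhood \<open>\<integral> f \<in> U\<close> two
  thresholds halfway to the boundary of an interval inside \<open>U\<close> suffice; finite intersections of
  neighbourhoods become finite unions of complements.\<close>
lemma asymptotically_separated_nhd:
  fixes W :: "'a::second_countable_topology measure set"
  assumes "openin weak_topology W" "P \<in> W"
  shows "\<exists>V. openin weak_topology V \<and> P \<in> V \<and> asymptotically_separated V (borel_probs - W)"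
proof -
  let ?S = "{{\<mu> \<in> borel_probs. (\<integral>x. f x \<partial>\<mu>) \<in> U} | (f :: 'a \<Rightarrow> real) U.
        continuous_on UNIV f \<and> bounded (range f) \<and> open U}"
  have "generate_topology_on ?S W"
    using assms(1) unfolding weak_topology_def openin_topology_generated_by_iff .
  then show ?thesis using assms(2)
  proof (induction arbitrary: P)
    case (Int W1 W2)
    then obtain V1 V2 where
      "openin weak_topology V1" "P \<in> V1" "asymptotically_separated V1 (borel_probs - W1)"
      "openin weak_topology V2" "P \<in> V2" "asymptotically_separated V2 (borel_probs - W2)" by blast
    moreover from this have "asymptotically_separated (V1 \<inter> V2) ((borel_probs - W1) \<union> (borel_probs - W2))"
      by (intro asymptotically_separated_Un) (auto elim: asymptotically_separated_mono)
    ultimately show ?case by (intro exI[of _ "V1 \<inter> V2"]) (simp add: openin_Int Diff_Int)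
  next
    case (UN \<K>)
    then obtain W V where "W \<in> \<K>" "openin weak_topology V" "P \<in> V"
      "asymptotically_separated V (borel_probs - W)" by blast
    then show ?case
      by (intro exI[of _ V] conjI) (auto elim: asymptotically_separated_mono)
  next
    case (Basis W)
    then obtain f :: "'a \<Rightarrow> real" and U where
      W: "W = {\<mu> \<in> borel_probs. (\<integral>x. f x \<partial>\<mu>) \<in> U}" and f: "bounded_continuous f" and U: "open U"
      by blast
    let ?m = "\<integral>x. f x \<partial>P"
    obtain e where e: "e > 0" "ball ?m e \<subseteq> U" using U Basis(2) W openE by blast
    define V where "V = {\<mu> \<in> borel_probs. (\<integral>x. f x \<partial>\<mu>) \<in> ball ?m (e / 2)}"
    have "openin weak_topology V" unfolding V_def using f by (rule openin_weak_integral) simp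
    moreover have "P \<in> V" using Basis(2) W e by (simp add: V_def)
    moreover have "asymptotically_separated V (borel_probs - W)"
    proof (rule asymptotically_separated_mono[OF asymptotically_separated_Un])
      let ?a = "?m - e / 2" and ?b = "?m + e / 2"
      show "asymptotically_separated V {\<mu> \<in> borel_probs. (\<integral>x. f x \<partial>\<mu>) < ?a}"
        by (rule asymptotically_separated_mono[OF asymptotically_separated_integral[OF f, of ?a]])
           (auto simp: V_def dist_real_def abs_if split: if_splits)
      show "asymptotically_separated V {\<mu> \<in> borel_probs. ?b < (\<integral>x. f x \<partial>\<mu>)}"
        by (rule asymptotically_separated_mono[OF
              asymptotically_separated_sym[OF asymptotically_separated_integral[OF f, of ?b]]])
           (auto simp: V_def dist_real_def abs_if split: if_splits)
      show "borel_probs - W \<subseteq> {\<mu> \<in> borel_probs. (\<integral>x. f x \<partial>\<mu>) < ?a} \<union> {\<mu> \<in> borel_probs. ?b < (\<integral>x. f x \<partial>\<mu>)}"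
      proof
        fix \<mu> assume \<mu>: "\<mu> \<in> borel_probs - W"
        then have "(\<integral>x. f x \<partial>\<mu>) \<notin> ball ?m e" using e(2) W by blast
        then have "e \<le> \<bar>?m - (\<integral>x. f x \<partial>\<mu>)\<bar>" by (simp add: dist_real_def)
        then show "\<mu> \<in> {\<mu> \<in> borel_probs. (\<integral>x. f x \<partial>\<mu>) < ?a} \<union> {\<mu> \<in> borel_probs. ?b < (\<integral>x. f x \<partial>\<mu>)}"
          using \<mu> e(1) by (simp add: abs_if split: if_splits)
      qed
    qed simp
    ultimately show ?case by blast
  qed simp
qed

text \<open>Indicators of open sets are limits of bounded continuous functions, so the measures agree on
  the open sets, a generator that is closed under intersections.\<close>
lemma borel_probs_eqI:
  fixes P Q :: "'a::{metric_space, second_countable_topology} measure"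
  assumes P: "P \<in> borel_probs" and Q: "Q \<in> borel_probs"
    and eq: "\<And>f. bounded_continuous f \<Longrightarrow> (\<integral>x. f x \<partial>P) = (\<integral>x. f x \<partial>Q)"
  shows "P = Q"
proof -
  have lim: "(\<lambda>k. \<integral>x. f k x \<partial>M) \<longlonglongrightarrow> measure M U"
    if M: "M \<in> borel_probs" and U: "open U" and f: "\<forall>k. bounded_continuous (f k)"
      "\<forall>k x. 0 \<le> f k x \<and> f k x \<le> indicator U x" "\<forall>x. (\<lambda>k. f k x) \<longlonglongrightarrow> indicator U x"
    for M :: "'a measure" and U and f :: "nat \<Rightarrow> 'a \<Rightarrow> real"
  proof -
    interpret prob_space M using M by (rule borel_probsD)
    have "(\<lambda>k. \<integral>x. f k x \<partial>M) \<longlonglongrightarrow> (\<integral>x. indicator U x \<partial>M)"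
    proof (rule integral_dominated_convergence[where w = "\<lambda>_. 1"])
      show "AE x in M. norm (f k x) \<le> 1" for k
      proof (rule AE_I2)
        fix x
        have "indicator U x \<le> (1::real)" by (rule indicator_le_1)
        then have "0 \<le> f k x \<and> f k x \<le> 1" using f(2)[rule_format, of k x] by linarith
        then show "norm (f k x) \<le> 1" by simp
      qed
      show "f k \<in> borel_measurable M" for k
        using integrable_bounded_continuous[OF M] f(1) by blast
      show "(indicator U :: 'a \<Rightarrow> real) \<in> borel_measurable M"
        using U borel_probsD(2)[OF M] by (intro borel_measurable_indicator) simp
    qed (use f(3) in auto)
    then show ?thesis using borel_probsD(3)[OF M] by simp
  qed
  have "measure P U = measure Q U" if U: "open U" for U
  proof -
    obtain f :: "nat \<Rightarrow> 'a \<Rightarrow> real" where f: "\<forall>k. bounded_continuous (f k)"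
      "\<forall>k x. 0 \<le> f k x \<and> f k x \<le> indicator U x" "\<forall>x. (\<lambda>k. f k x) \<longlonglongrightarrow> indicator U x"
      using U by (rule open_indicator_approximation)
    have "(\<lambda>k. \<integral>x. f k x \<partial>P) = (\<lambda>k. \<integral>x. f k x \<partial>Q)" by (intro ext eq f(1)[rule_format])
    then show ?thesis using lim[OF P U f] lim[OF Q U f] LIMSEQ_unique by metis
  qed
  then have "emeasure P U = emeasure Q U" if "open U" for U
    using that prob_space.finite_measure[OF borel_probsD(1)[OF P]]
      prob_space.finite_measure[OF borel_probsD(1)[OF Q]]
    by (simp add: finite_measure.emeasure_eq_measure)
  then show "P = Q"
    using prob_space.emeasure_space_1[OF borel_probsD(1)[OF P]] borel_probsD(2,3)[OF P] borel_probsD(2)[OF Q]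
    by (intro measure_eqI_generator_eq[where E = "{U. open U}" and \<Omega> = UNIV and A = "\<lambda>_. UNIV"])
       (auto simp: Int_stable_def borel_def)
qed

lemma asymptotically_separated_distinct:
  fixes P Q :: "'a::{metric_space, second_countable_topology} measure"
  assumes P: "P \<in> borel_probs" and Q: "Q \<in> borel_probs" and ne: "P \<noteq> Q"
  shows "asymptotically_separated {P} {Q}"
proof -
  obtain f where f: "bounded_continuous f" and neq: "(\<integral>x. f x \<partial>P) \<noteq> (\<integral>x. f x \<partial>Q)"
    using borel_probs_eqI[OF P Q] ne by metis
  let ?W = "{\<mu> \<in> borel_probs. (\<integral>x. f x \<partial>\<mu>) \<in> - {\<integral>x. f x \<partial>Q}}"
  have "openin weak_topology ?W" using f by (intro openin_weak_integral) auto
  then obtain V where "P \<in> V" "asymptotically_separated V (borel_probs - ?W)"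
    using asymptotically_separated_nhd[of ?W P] P neq by auto
  then show ?thesis using Q by (elim asymptotically_separated_mono) auto
qed

lemma asymptotically_separated_finite:
  fixes S T :: "'a::{metric_space, second_countable_topology} measure set"
  assumes "finite S" "finite T" "S \<inter> T = {}" "S \<subseteq> borel_probs" "T \<subseteq> borel_probs"
  shows "asymptotically_separated S T"
proof -
  have single: "asymptotically_separated {P} T" if P: "P \<in> S" for P
    using assms(2,3,5)
  proof (induction T)
    case empty
    then show ?case using P assms(4) by (intro asymptotically_separated_empty) auto
  next
    case (insert Q T)
    then have "asymptotically_separated {P} ({Q} \<union> T)"
      using P assms(4)
      by (intro asymptotically_separated_Un asymptotically_separated_distinct) auto
    then show ?case by simp
  qed
  show ?thesis using assms(1) single
  proof (induction S)
    case empty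
    show ?case using assms(5)
      by (intro asymptotically_separated_sym[OF asymptotically_separated_empty])
  next
    case (insert P S)
    then have "asymptotically_separated ({P} \<union> S) T"
      by (intro asymptotically_separated_Un_left) auto
    then show ?case by simp
  qed
qed

text \<open>Level \<open>k\<close> of a triangular family controls the indices up to \<open>k\<close> only. Letting the level grow slowly
  enough with \<open>n\<close> controls every index.\<close>
lemma diagonal_tendsto_1:
  fixes a :: "nat \<Rightarrow> nat \<Rightarrow> nat \<Rightarrow> real"
  assumes lim: "\<And>k i. i \<le> k \<Longrightarrow> (\<lambda>n. a k i n) \<longlonglongrightarrow> 1" and le: "\<And>k i n. a k i n \<le> 1"
  shows "\<exists>m. \<forall>i. (\<lambda>n. a (m n) i n) \<longlonglongrightarrow> 1"
proof -
  have "\<forall>\<^sub>F n in sequentially. \<forall>i\<in>{..k}. a k i n > 1 - 1 / real (Suc k)" for k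
    using order_tendstoD(1)[OF lim] by (intro eventually_ball_finite) auto
  then obtain N where N: "\<And>k n i. N k \<le> n \<Longrightarrow> i \<le> k \<Longrightarrow> a k i n > 1 - 1 / real (Suc k)"
    unfolding eventually_sequentially by (metis atMost_iff)
  \<comment> \<open>The highest level that is already close to 1 at time \<open>n\<close>; the bound \<open>k \<le> n\<close> keeps the
    set finite, and 0 serves until a level is available.\<close>
  define m where "m n = Max (insert 0 {k. k \<le> n \<and> N k \<le> n})" for n
  have m_ge: "k \<le> m n" if "k \<le> n" "N k \<le> n" for k n
    using that unfolding m_def by (intro Max_ge) auto
  have Nm: "N (m n) \<le> n" if "N 0 \<le> n" for n
  proof -
    have "m n \<in> insert 0 {k. k \<le> n \<and> N k \<le> n}" unfolding m_def by (intro Max_in) auto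
    then show ?thesis using that by auto
  qed
  have "(\<lambda>n. a (m n) i n) \<longlonglongrightarrow> 1" for i
  proof (rule order_tendstoI)
    fix c :: real assume "1 < c"
    then show "\<forall>\<^sub>F n in sequentially. a (m n) i n < c" using le by (intro always_eventually) (auto intro: le_less_trans)
  next
    fix c :: real assume "c < 1"
    then obtain K where K: "inverse (real (Suc K)) < 1 - c" using reals_Archimedean[of "1 - c"] by auto
    define k where "k = max i K"
    have "c < a (m n) i n" if n: "n \<ge> max (N 0) (max k (N k))" for n
    proof -
      have mk: "k \<le> m n" using n by (intro m_ge) auto
      then have "1 / real (Suc (m n)) \<le> inverse (real (Suc K))"
        by (simp add: k_def field_simps)
      moreover have "a (m n) i n > 1 - 1 / real (Suc (m n))"
        using n mk by (intro N Nm) (auto simp: k_def)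
      ultimately show ?thesis using K by linarith
    qed
    then show "\<forall>\<^sub>F n in sequentially. c < a (m n) i n" unfolding eventually_sequentially by blast
  qed
  then show ?thesis by blast
qed

text \<open>Separate the first \<open>k + 1\<close> members of each enumeration and let \<open>k\<close> grow slowly with the sample size.\<close>
lemma asymptotically_separated_countable:
  fixes S T :: "'a::{metric_space, second_countable_topology} measure set"
  assumes "countable S" "countable T" "S \<inter> T = {}" "S \<subseteq> borel_probs" "T \<subseteq> borel_probs"
  shows "asymptotically_separated S T"
proof (cases "S = {} \<or> T = {}")
  case True
  then show ?thesis
    using asymptotically_separated_empty[OF assms(4)]
      asymptotically_separated_sym[OF asymptotically_separated_empty[OF assms(5)]] by blast
next
  case False
  define p q where "p = from_nat_into S" and "q = from_nat_into T"
  have pq: "S = range p" "T = range q" using False assms(1,2) by (simp_all add: p_def q_def)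
  have "\<exists>AB. separates_along (fst AB) (snd AB) (p ` {..k}) (q ` {..k})" for k
  proof -
    have "p ` {..k} \<subseteq> S" "q ` {..k} \<subseteq> T" unfolding pq by auto
    then have "asymptotically_separated (p ` {..k}) (q ` {..k})"
      using assms(3-5) by (intro asymptotically_separated_finite) auto
    then show ?thesis unfolding asymptotically_separated_def by simp
  qed
  then obtain AB where "separates_along (fst (AB k)) (snd (AB k)) (p ` {..k}) (q ` {..k})" for k
    by metis
  note AB = separates_alongD[OF this]
  define A B where "A k = fst (AB k)" and "B k = snd (AB k)" for k
  \<comment> \<open>The minimum lets one diagonal sequence of levels serve both enumerations.\<close>
  define a where "a k i n =
    min (measure (power_measure (p i) n) (A k n)) (measure (power_measure (q i) n) (B k n))" for k i n
  have probs: "p i \<in> borel_probs" "q i \<in> borel_probs" for i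
    using assms(4,5) unfolding pq by auto
  note le_1 = prob_space.prob_le_1[OF prob_space_power_measure]
  have "(\<lambda>n. a k i n) \<longlonglongrightarrow> min 1 1" if "i \<le> k" for i k
    unfolding a_def A_def B_def by (intro tendsto_min AB(6) AB(7)) (use that in auto)
  moreover have "a k i n \<le> 1" for k i n
    unfolding a_def using le_1[OF probs(1)] by (rule min.coboundedI1)
  ultimately obtain m where m: "\<And>i. (\<lambda>n. a (m n) i n) \<longlonglongrightarrow> 1"
    using diagonal_tendsto_1[of a] by auto
  show ?thesis
  proof (rule asymptotically_separatedI[OF assms(4,5)])
    show "openin (power_top n) (A (m n) n)" "openin (power_top n) (B (m n) n)" for n
      unfolding A_def B_def by (rule AB)+
    show "A (m n) n \<inter> B (m n) n = {}" for n
      unfolding A_def B_def by (rule AB)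
    show "(\<lambda>n. measure (power_measure P n) (A (m n) n)) \<longlonglongrightarrow> 1" if PS: "P \<in> S" for P
    proof -
      obtain i where i: "P = p i" using PS unfolding pq by blast
      show ?thesis unfolding i
        by (rule tendsto_sandwich[OF always_eventually always_eventually m[of i] tendsto_const])
          (simp_all add: a_def le_1[OF probs(1)])
    qed
    show "(\<lambda>n. measure (power_measure P n) (B (m n) n)) \<longlonglongrightarrow> 1" if PT: "P \<in> T" for P
    proof -
      obtain i where i: "P = q i" using PT unfolding pq by blast
      show ?thesis unfolding i
        by (rule tendsto_sandwich[OF always_eventually always_eventually m[of i] tendsto_const])
          (simp_all add: a_def le_1[OF probs(2)])
    qed
  qed
qed

section \<open>Hereditary separability of the weak topology\<close>

definition lower_semicontinuous_on_probs ::
  "'a::topological_space measure topology \<Rightarrow> ('a measure \<Rightarrow> real) \<Rightarrow> bool" where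
  "lower_semicontinuous_on_probs \<tau> g \<longleftrightarrow> (\<forall>c. openin \<tau> {P \<in> borel_probs. c < g P})"

lemma lower_semicontinuous_on_probs_const:
  assumes "topspace \<tau> = borel_probs"
  shows "lower_semicontinuous_on_probs \<tau> (\<lambda>_. a)"
  unfolding lower_semicontinuous_on_probs_def
proof
  fix c
  show "openin \<tau> {P \<in> borel_probs. c < a}"
    using openin_topspace[of \<tau>] assms by (cases "c < a") simp_all
qed

lemma lower_semicontinuous_on_probs_add:
  assumes "lower_semicontinuous_on_probs \<tau> g" "lower_semicontinuous_on_probs \<tau> h"
  shows "lower_semicontinuous_on_probs \<tau> (\<lambda>P. g P + h P)"
  unfolding lower_semicontinuous_on_probs_def
proof
  fix c
  have "\<exists>r. r < g P \<and> c - r < h P" if "c < g P + h P" for P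
    using dense[of "c - h P" "g P"] that by auto
  then have "{P \<in> borel_probs. c < g P + h P} =
      (\<Union>r. {P \<in> borel_probs. r < g P} \<inter> {P \<in> borel_probs. c - r < h P})"
    by fastforce
  also have "openin \<tau> \<dots>"
    using assms unfolding lower_semicontinuous_on_probs_def by (intro openin_Union) (auto intro: openin_Int)
  finally show "openin \<tau> {P \<in> borel_probs. c < g P + h P}" .
qed

lemma lower_semicontinuous_on_probs_sum:
  assumes "topspace \<tau> = borel_probs" "\<And>i. i \<in> I \<Longrightarrow> lower_semicontinuous_on_probs \<tau> (g i)"
  shows "lower_semicontinuous_on_probs \<tau> (\<lambda>P. \<Sum>i\<in>I. g i P)"
  using assms(2)
  by (induction I rule: infinite_finite_induct)
    (auto intro: lower_semicontinuous_on_probs_const[OF assms(1)] lower_semicontinuous_on_probs_add)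

lemma lower_semicontinuous_on_probs_divide:
  assumes "lower_semicontinuous_on_probs \<tau> g" "a > 0"
  shows "lower_semicontinuous_on_probs \<tau> (\<lambda>P. g P / a)"
  using assms unfolding lower_semicontinuous_on_probs_def by (simp add: pos_less_divide_eq)

text \<open>The sum counts the positive integers below \<open>t\<close>.\<close>
lemma staircase_bounds:
  fixes t :: real
  assumes "0 \<le> t" "t \<le> real N"
  shows "t - 1 \<le> (\<Sum>i = 1..N. of_bool (real i < t))" "(\<Sum>i = 1..N. of_bool (real i < t)) \<le> t"
proof -
  have "t - 1 \<le> (\<Sum>i = 1..N. of_bool (real i < t)) \<and> (\<Sum>i = 1..N. of_bool (real i < t)) \<le> t"
    using assms
  proof (induction N)
    case (Suc N)
    show ?case
    proof (cases "t \<le> real N")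
      case True
      then show ?thesis using Suc by simp
    next
      case False
      then have "(\<Sum>i = 1..N. of_bool (real i < t)) = (\<Sum>i = 1..N. (1::real))"
        by (intro sum.cong) auto
      then show ?thesis using False Suc.prems by simp
    qed
  qed simp
  then show "t - 1 \<le> (\<Sum>i = 1..N. of_bool (real i < t))" "(\<Sum>i = 1..N. of_bool (real i < t)) \<le> t"
    by auto
qed

text \<open>After the shift \<open>f + B \<ge> 0\<close>, a staircase of step \<open>1 / (k + 1)\<close> approximates \<open>f + B\<close> from below to within its
  step. The integral of the staircase is a positive combination of measures of the open sets
  where \<open>f + B\<close> exceeds a multiple of the step, so the integral of \<open>f\<close> is a supremum of lower
  semicontinuous functions.\<close>
lemma lower_semicontinuous_on_probs_integral:
  fixes f :: "'a::topological_space \<Rightarrow> real"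
  assumes top: "topspace \<tau> = borel_probs"
    and lsc: "\<And>U. open U \<Longrightarrow> lower_semicontinuous_on_probs \<tau> (\<lambda>P. measure P U)"
    and f: "bounded_continuous f"
  shows "lower_semicontinuous_on_probs \<tau> (\<lambda>P. \<integral>x. f x \<partial>P)"
proof -
  obtain B where B: "B > 0" "\<And>x. \<bar>f x\<bar> \<le> B" using f by (auto simp: bounded_pos)
  obtain M :: nat where M: "2 * B \<le> real M" using real_arch_simple by blast
  define U where "U k i = {x. real i / real (Suc k) < f x + B}" for k i :: nat
  define g where "g k P = (\<Sum>i = 1..Suc k * M. measure P (U k i)) / real (Suc k)"
    for k and P :: "'a measure"
  have opU: "open (U k i)" for k i
    unfolding U_def by (intro open_Collect_less continuous_intros) (use f in simp)
  have lscg: "lower_semicontinuous_on_probs \<tau> (g k)" for k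
    unfolding g_def
    by (intro lower_semicontinuous_on_probs_divide lower_semicontinuous_on_probs_sum[OF top] lsc opU) simp
  have g: "g k P \<le> (\<integral>x. f x \<partial>P) + B" "(\<integral>x. f x \<partial>P) + B - 1 / real (Suc k) \<le> g k P"
    if P: "P \<in> borel_probs" for k P
  proof -
    interpret prob_space P using P by (rule borel_probsD)
    note int = integrable_bounded_continuous[OF P f]
    define s where "s x = (\<Sum>i = 1..Suc k * M. indicator (U k i) x) / real (Suc k)" for x
    have ms: "U k i \<in> sets P" for i using opU borel_probsD(2)[OF P] by simp
    have intU: "integrable P (indicator (U k i) :: 'a \<Rightarrow> real)" for i
      using ms by (simp add: integrable_indicator_iff emeasure_eq_measure)
    have ints: "integrable P s"
      unfolding s_def by (intro integrable_divide Bochner_Integration.integrable_sum intU)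
    have gs: "g k P = (\<integral>x. s x \<partial>P)"
      unfolding s_def g_def using intU borel_probsD(3)[OF P] by (simp add: integral_sum)
    have s: "f x + B - 1 / real (Suc k) \<le> s x" "s x \<le> f x + B" for x
    proof -
      let ?t = "real (Suc k) * (f x + B)"
      have fx: "0 \<le> f x + B" "f x + B \<le> real M" using B(2)[of x] M by (simp_all add: abs_le_iff)
      have t: "0 \<le> ?t" "?t \<le> real (Suc k * M)"
        using fx mult_left_mono[OF fx(2), of "real (Suc k)"] by (simp_all only: of_nat_mult) simp
      have "indicator (U k i) x = (of_bool (real i < ?t) :: real)" for i
        by (simp add: U_def indicator_def pos_divide_less_eq mult.commute)
      then have "s x = (\<Sum>i = 1..Suc k * M. of_bool (real i < ?t)) / real (Suc k)"
        by (simp add: s_def)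
      then have sx: "s x * real (Suc k) = (\<Sum>i = 1..Suc k * M. of_bool (real i < ?t))" by simp
      have "(f x + B - 1 / real (Suc k)) * real (Suc k) \<le> s x * real (Suc k)"
      proof -
        have "(y - 1 / r) * r = r * y - 1" if "r > 0" for y r :: real
          using that by (simp add: field_simps)
        then have "(f x + B - 1 / real (Suc k)) * real (Suc k) = ?t - 1"
          by (metis of_nat_0_less_iff zero_less_Suc)
        then show ?thesis unfolding sx using staircase_bounds(1)[OF t] by simp
      qed
      then show "f x + B - 1 / real (Suc k) \<le> s x" by (rule mult_right_le_imp_le) simp
      have "s x * real (Suc k) \<le> (f x + B) * real (Suc k)"
        unfolding sx using staircase_bounds(2)[OF t] by (simp add: mult.commute)
      then show "s x \<le> f x + B" by (rule mult_right_le_imp_le) simp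
    qed
    have "(\<integral>x. s x \<partial>P) \<le> (\<integral>x. f x + B \<partial>P)"
      using ints int s by (intro integral_mono) auto
    also have "\<dots> = (\<integral>x. f x \<partial>P) + B" using int by (simp add: prob_space)
    finally show "g k P \<le> (\<integral>x. f x \<partial>P) + B" by (simp add: gs)
    have "(\<integral>x. f x \<partial>P) + B - 1 / real (Suc k) = (\<integral>x. f x + (B - 1 / real (Suc k)) \<partial>P)"
      using int by (simp add: prob_space)
    also have "\<dots> \<le> (\<integral>x. s x \<partial>P)"
      using ints int s(1) by (intro integral_mono) (auto simp: algebra_simps)
    finally show "(\<integral>x. f x \<partial>P) + B - 1 / real (Suc k) \<le> g k P" by (simp add: gs)
  qed
  show ?thesis unfolding lower_semicontinuous_on_probs_def
  proof
    fix c
    have "c < (\<integral>x. f x \<partial>P) \<longleftrightarrow> (\<exists>k. c + B < g k P)" if P: "P \<in> borel_probs" for P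
    proof
      assume "c < (\<integral>x. f x \<partial>P)"
      then obtain k where "inverse (real (Suc k)) < (\<integral>x. f x \<partial>P) - c"
        using reals_Archimedean[of "(\<integral>x. f x \<partial>P) - c"] by auto
      then have "c + B < g k P" using g(2)[OF P, of k] by (simp add: inverse_eq_divide)
      then show "\<exists>k. c + B < g k P" ..
    next
      assume "\<exists>k. c + B < g k P"
      then obtain k where "c + B < g k P" ..
      then show "c < (\<integral>x. f x \<partial>P)" using g(1)[OF P, of k] by linarith
    qed
    then have "{P \<in> borel_probs. c < (\<integral>x. f x \<partial>P)} = (\<Union>k. {P \<in> borel_probs. c + B < g k P})"
      by auto
    also have "openin \<tau> \<dots>"
      using lscg unfolding lower_semicontinuous_on_probs_def by (intro openin_Union) auto
    finally show "openin \<tau> {P \<in> borel_probs. c < (\<integral>x. f x \<partial>P)}" .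
  qed
qed

text \<open>One direction of the portmanteau theorem, as a comparison of topologies: lower semicontinuity
  of the measures of open sets gives lower semicontinuity of \<open>\<integral> f\<close> and of \<open>\<integral> -f\<close>, hence continuity of
  \<open>\<integral> f\<close>.\<close>
lemma openin_weak_imp_openin_if_lsc:
  fixes \<tau> :: "'a::topological_space measure topology"
  assumes top: "topspace \<tau> = borel_probs"
    and lsc: "\<And>U. open U \<Longrightarrow> lower_semicontinuous_on_probs \<tau> (\<lambda>P. measure P U)"
    and W: "openin weak_topology W"
  shows "openin \<tau> W"
proof -
  let ?S = "{{\<mu> \<in> borel_probs. (\<integral>x. f x \<partial>\<mu>) \<in> U} | (f :: 'a \<Rightarrow> real) U.
        continuous_on UNIV f \<and> bounded (range f) \<and> open U}"
  have basis: "openin \<tau> {\<mu> \<in> borel_probs. (\<integral>x. f x \<partial>\<mu>) \<in> U}" (is "openin \<tau> ?W")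
    if f: "bounded_continuous f" and U: "open U" for f :: "'a \<Rightarrow> real" and U
  proof (subst openin_subopen, intro ballI)
    fix P assume P: "P \<in> ?W"
    let ?m = "\<integral>x. f x \<partial>P"
    obtain e where e: "e > 0" "ball ?m e \<subseteq> U" using U P openE by blast
    have f': "bounded_continuous (\<lambda>x. - f x)"
      using f by (rule bounded_continuous_minus)
    define V where "V = {\<mu> \<in> borel_probs. ?m - e < (\<integral>x. f x \<partial>\<mu>)} \<inter>
      {\<mu> \<in> borel_probs. - (?m + e) < (\<integral>x. - f x \<partial>\<mu>)}"
    have "openin \<tau> V" unfolding V_def
      using lower_semicontinuous_on_probs_integral[OF top lsc f]
        lower_semicontinuous_on_probs_integral[OF top lsc f']
      unfolding lower_semicontinuous_on_probs_def by (intro openin_Int) blast+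
    moreover have "P \<in> V" using P e by (simp add: V_def)
    moreover have "V \<subseteq> ?W"
    proof
      fix \<mu> assume \<mu>: "\<mu> \<in> V"
      then have "(\<integral>x. f x \<partial>\<mu>) \<in> ball ?m e" by (simp add: V_def dist_real_def abs_less_iff)
      then show "\<mu> \<in> ?W" using e(2) \<mu> by (auto simp: V_def)
    qed
    ultimately show "\<exists>T. openin \<tau> T \<and> P \<in> T \<and> T \<subseteq> ?W" by blast
  qed
  have "generate_topology_on ?S W"
    using W unfolding weak_topology_def openin_topology_generated_by_iff .
  then show ?thesis
  proof induction
    case (Basis s)
    then show ?case using basis by blast
  qed (auto intro: openin_Int)
qed

lemma second_countable_topology_generated_by:
  assumes "countable \<G>"
  shows "second_countable (topology_generated_by \<G>)"
proof -
  define \<B> where "\<B> = Inter ` {F. finite F \<and> F \<subseteq> \<G> \<and> F \<noteq> {}}"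
  have "countable {F. finite F \<and> F \<subseteq> \<G>}" using assms by (rule countable_Collect_finite_subset)
  then have cB: "countable \<B>" unfolding \<B>_def by (intro countable_image) (auto elim: countable_subset[rotated])
  have open_B: "openin (topology_generated_by \<G>) V" if V: "V \<in> \<B>" for V
  proof -
    obtain F where F: "V = \<Inter>F" "finite F" "F \<subseteq> \<G>" "F \<noteq> {}" using V unfolding \<B>_def by blast
    then have "openin (topology_generated_by \<G>) W" if "W \<in> F" for W
      using that by (intro topology_generated_by_Basis) blast
    then show ?thesis unfolding F(1) using F(2,4) by (intro openin_Inter) auto
  qed
  have Int_closed: "V \<inter> V' \<in> \<B>" if V: "V \<in> \<B>" and V': "V' \<in> \<B>" for V V'
  proof -
    obtain F where F: "V = \<Inter>F" "finite F" "F \<subseteq> \<G>" "F \<noteq> {}" using V unfolding \<B>_def by blast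
    obtain F' where F': "V' = \<Inter>F'" "finite F'" "F' \<subseteq> \<G>" "F' \<noteq> {}" using V' unfolding \<B>_def by blast
    have "V \<inter> V' = \<Inter>(F \<union> F')" unfolding F(1) F'(1) by (rule Inter_Un_distrib[symmetric])
    then show ?thesis unfolding \<B>_def using F F' by (intro image_eqI[of _ _ "F \<union> F'"]) auto
  qed
  have "\<exists>V\<in>\<B>. x \<in> V \<and> V \<subseteq> U" if "openin (topology_generated_by \<G>) U" "x \<in> U" for U x
  proof -
    have "generate_topology_on \<G> U" using that(1) by (simp add: openin_topology_generated_by_iff)
    then show ?thesis using that(2)
    proof (induction arbitrary: x)
      case (Int a b)
      from Int.IH(1)[of x] Int.IH(2)[of x] Int.prems
      obtain V V' where V: "V \<in> \<B>" "x \<in> V" "V \<subseteq> a" "V' \<in> \<B>" "x \<in> V'" "V' \<subseteq> b" by blast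
      then have "V \<inter> V' \<in> \<B>" by (intro Int_closed)
      then show ?case using V by (intro bexI[of _ "V \<inter> V'"]) auto
    next
      case (UN K)
      then obtain k where k: "k \<in> K" "x \<in> k" by blast
      from UN.IH[OF k] obtain V where "V \<in> \<B>" "x \<in> V" "V \<subseteq> k" by blast
      then show ?case using k(1) by (intro bexI[of _ V]) auto
    next
      case (Basis s)
      then have "\<Inter>{s} \<in> \<B>" unfolding \<B>_def by (intro imageI) simp
      then show ?case using Basis by auto
    qed simp
  qed
  then show ?thesis unfolding second_countable_def using cB open_B by (intro exI[of _ \<B>]) simp
qed

lemma measure_open_approx_finite_Union:
  fixes U :: "'a::topological_space set"
  assumes P: "P \<in> borel_probs" and F: "countable F" "\<And>V. V \<in> F \<Longrightarrow> open V" and c: "c < measure P (\<Union>F)"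
  shows "\<exists>F'\<subseteq>F. finite F' \<and> c < measure P (\<Union>F')"
proof (cases "F = {}")
  case True
  then show ?thesis using c by blast
next
  case False
  interpret prob_space P using P by (rule borel_probsD)
  define V where "V k = \<Union> (from_nat_into F ` {..<k})" for k :: nat
  have r: "range (from_nat_into F) = F" using False F(1) by (rule range_from_nat_into)
  have sub: "from_nat_into F ` {..<k} \<subseteq> F" for k using r by blast
  have "(\<lambda>k. prob (V k)) \<longlonglongrightarrow> prob (\<Union>k. V k)"
  proof (rule finite_Lim_measure_incseq)
    have "open (V k)" for k unfolding V_def using sub F(2) by (intro open_Union) blast
    then show "range V \<subseteq> events" using borel_probsD(2)[OF P] by auto
    show "incseq V" unfolding V_def
      by (intro incseq_SucI Union_mono image_mono lessThan_subset_iff[THEN iffD2]) simp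
  qed
  moreover have "(\<Union>k. V k) = \<Union>F"
  proof -
    have "(\<Union>k. V k) = \<Union> (range (from_nat_into F))" unfolding V_def by auto
    then show ?thesis by (simp only: r)
  qed
  ultimately have "\<forall>\<^sub>F k in sequentially. c < prob (V k)" using c order_tendstoD(1) by metis
  then obtain k where "c < prob (V k)" by (auto simp: eventually_sequentially)
  then show ?thesis unfolding V_def using sub by blast
qed

text \<open>The sets \<open>{P. P(V) > q}\<close> with rational \<open>q\<close> and \<open>V\<close> a finite union of basic open sets generate a
  second countable topology that is at least as fine as the weak one. Its subspaces are separable,
  and a set that is dense for a finer topology is dense for the coarser one.\<close>
lemma weak_topology_hereditarily_separable:
  fixes H :: "'a::second_countable_topology measure set"
  assumes H: "H \<subseteq> borel_probs"
  shows "\<exists>D. countable D \<and> dense_in (subtopology weak_topology H) D"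
proof -
  obtain \<B> :: "'a set set" where B: "countable \<B>" "topological_basis \<B>"
    using ex_countable_basis by blast
  define G where "G F q = {P \<in> borel_probs. real_of_rat q < measure P (\<Union>F)}" for F :: "'a set set" and q
  define \<G> where "\<G> = case_prod G ` ({F. finite F \<and> F \<subseteq> \<B>} \<times> UNIV)"
  define \<tau> where "\<tau> = topology_generated_by \<G>"
  have "countable {F. finite F \<and> F \<subseteq> \<B>}" using B(1) by (rule countable_Collect_finite_subset)
  then have "countable \<G>" unfolding \<G>_def by (intro countable_image countable_SIGMA) auto
  then have sc: "second_countable \<tau>" unfolding \<tau>_def by (rule second_countable_topology_generated_by)
  have G_in: "G F q \<in> \<G>" if "finite F" "F \<subseteq> \<B>" for F q
    unfolding \<G>_def using that by force
  then have opG: "openin \<tau> (G F q)" if "finite F" "F \<subseteq> \<B>" for F q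
    unfolding \<tau>_def using that by (intro topology_generated_by_Basis)
  \<comment> \<open>The negative threshold makes the generating sets cover the whole space.\<close>
  have "G {} (- 1) = borel_probs" unfolding G_def by simp
  then have "\<Union>\<G> = borel_probs" using G_in[of "{}" "- 1"] unfolding \<G>_def G_def by auto
  then have top: "topspace \<tau> = borel_probs" unfolding \<tau>_def topology_generated_by_topspace .
  have lsc: "lower_semicontinuous_on_probs \<tau> (\<lambda>P. measure P U)" if U: "open U" for U
    unfolding lower_semicontinuous_on_probs_def
  proof
    fix c
    obtain F where F: "F \<subseteq> \<B>" "\<Union>F = U" using B(2) U unfolding topological_basis_def by blast
    have opF: "open V" if "V \<in> F" for V using F(1) B(2) that topological_basis_open by blast
    show "openin \<tau> {P \<in> borel_probs. c < measure P U}"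
    proof (subst openin_subopen, intro ballI)
      fix P assume "P \<in> {P \<in> borel_probs. c < measure P U}"
      then have P: "P \<in> borel_probs" and c: "c < measure P (\<Union>F)" using F(2) by auto
      obtain F' where F': "F' \<subseteq> F" "finite F'" "c < measure P (\<Union>F')"
        using measure_open_approx_finite_Union[OF P countable_subset[OF F(1) B(1)] opF c] by blast
      obtain q where q: "c < real_of_rat q" "real_of_rat q < measure P (\<Union>F')"
        using of_rat_dense[OF F'(3)] by blast
      have "G F' q \<subseteq> {P \<in> borel_probs. c < measure P U}"
      proof
        fix Q assume "Q \<in> G F' q"
        then have Q: "Q \<in> borel_probs" "real_of_rat q < measure Q (\<Union>F')" by (simp_all add: G_def)
        interpret prob_space Q using Q(1) by (rule borel_probsD)
        have "prob (\<Union>F') \<le> prob U"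
          using F'(1) F(2) U borel_probsD(2)[OF Q(1)] by (intro finite_measure_mono) auto
        then show "Q \<in> {P \<in> borel_probs. c < measure P U}" using Q q(1) by simp
      qed
      moreover have "openin \<tau> (G F' q)" using F' F(1) by (intro opG) auto
      moreover have "P \<in> G F' q" using P q(2) by (simp add: G_def)
      ultimately show "\<exists>T. openin \<tau> T \<and> P \<in> T \<and> T \<subseteq> {P \<in> borel_probs. c < measure P U}" by blast
    qed
  qed
  have finer: "openin \<tau> W" if "openin weak_topology W" for W
    using top lsc that by (rule openin_weak_imp_openin_if_lsc)
  have "separable_space (subtopology \<tau> H)"
    using second_countable_subtopology[OF sc] by (rule second_countable_imp_separable_space)
  then obtain D where D: "countable D" "D \<subseteq> H" "subtopology \<tau> H closure_of D = H"
    unfolding separable_space_def using top H by (auto simp: Int_absorb1)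
  have "H \<subseteq> subtopology weak_topology H closure_of D"
  proof
    fix P assume P: "P \<in> H"
    show "P \<in> subtopology weak_topology H closure_of D"
      unfolding in_closure_of
    proof (intro conjI allI impI)
      show "P \<in> topspace (subtopology weak_topology H)" using P H by auto
      fix T assume T: "P \<in> T \<and> openin (subtopology weak_topology H) T"
      then have "openin (subtopology \<tau> H) T" using finer by (auto simp: openin_subtopology)
      moreover have "P \<in> subtopology \<tau> H closure_of D" using P D(3) by simp
      ultimately show "\<exists>y. y \<in> D \<and> y \<in> T" using T unfolding in_closure_of by blast
    qed
  qed
  then have "dense_in (subtopology weak_topology H) D"
    unfolding dense_in_def using D(2) H closure_of_subset_topspace[of "subtopology weak_topology H" D] by auto
  then show ?thesis using D(1) by blast
qed

section \<open>Category\<close>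

lemma dense_in_iff_Int_open:
  "dense_in X S \<longleftrightarrow> S \<subseteq> topspace X \<and> (\<forall>T. openin X T \<and> T \<noteq> {} \<longrightarrow> S \<inter> T \<noteq> {})"
  unfolding dense_in_def dense_intersects_open ..

lemma meager_in_subset:
  assumes "meager_in X S" "T \<subseteq> S"
  shows "meager_in X T"
proof -
  obtain \<F> where F: "countable \<F>" "\<And>A. A \<in> \<F> \<Longrightarrow> nowhere_dense_in X A" "S = \<Union>\<F>"
    using assms(1) unfolding meager_in_def by blast
  have "nowhere_dense_in X (A \<inter> T)" if "A \<in> \<F>" for A
  proof -
    have "X interior_of (X closure_of (A \<inter> T)) \<subseteq> X interior_of (X closure_of A)"
      by (intro interior_of_mono closure_of_mono) simp
    then show ?thesis using F(2)[OF that] unfolding nowhere_dense_in_def by auto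
  qed
  then have nwd: "\<forall>A\<in>(\<lambda>A. A \<inter> T) ` \<F>. nowhere_dense_in X A" by blast
  have "T = \<Union>((\<lambda>A. A \<inter> T) ` \<F>)" using assms(2) F(3) by blast
  then show ?thesis unfolding meager_in_def
    by (intro exI[of _ "(\<lambda>A. A \<inter> T) ` \<F>"] conjI countable_image F(1) nwd)
qed

lemma nowhere_dense_in_compl_open_dense:
  assumes "openin X U" "dense_in X U"
  shows "nowhere_dense_in X (topspace X - U)"
proof -
  have "X closure_of (topspace X - U) = topspace X - U"
    using assms(1) by (intro closure_of_closedin closedin_diff) auto
  moreover have "X interior_of (topspace X - U) = topspace X - X closure_of U"
    by (rule interior_of_complement)
  ultimately show ?thesis using assms(2) unfolding nowhere_dense_in_def dense_in_def by simp
qed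

lemma Baire_space_open_not_meager:
  assumes "Baire_space X" "openin X G" "G \<noteq> {}"
  shows "\<not> meager_in X G"
proof
  assume "meager_in X G"
  moreover have "topspace X - (topspace X - G) = G" using openin_subset[OF assms(2)] by blast
  ultimately have "dense_in X (topspace X - G)"
    using assms(1) unfolding Baire_space_def comeager_in_def by auto
  then show False using assms(2,3) unfolding dense_in_iff_Int_open by blast
qed

section \<open>A consistent test when the hypotheses are not intertwined\<close>

lemma asymptotically_separated_imp_test:
  fixes S T :: "'a::second_countable_topology measure set"
  assumes "asymptotically_separated S T"
  shows "\<exists>\<phi>. is_test \<phi> \<and> finite_precision \<phi> \<and>
    (\<forall>P\<in>S. converges_to_verdict \<phi> Accept0 P) \<and> (\<forall>P\<in>T. converges_to_verdict \<phi> Accept1 P)"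
proof -
  obtain A B where "separates_along A B S T"
    using assms unfolding asymptotically_separated_def by blast
  note AB = separates_alongD[OF this]
  define \<phi> where "\<phi> n x = (if x \<in> A n then Accept0 else if x \<in> B n then Accept1 else Undecided)"
    for n x
  have sub: "A n \<subseteq> {..<n} \<rightarrow>\<^sub>E UNIV" "B n \<subseteq> {..<n} \<rightarrow>\<^sub>E UNIV" for n
    using openin_subset[OF AB(3)] openin_subset[OF AB(4)] by simp_all
  have v0: "verdict_set \<phi> n Accept0 = A n" for n
    using sub(1)[of n] unfolding verdict_set_def \<phi>_def by auto
  have v1: "verdict_set \<phi> n Accept1 = B n" for n
    using sub(2)[of n] AB(5)[of n] unfolding verdict_set_def \<phi>_def by auto
  have "\<phi> n \<in> (\<Pi>\<^sub>M i\<in>{..<n}. borel) \<rightarrow>\<^sub>M count_space UNIV" for n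
  proof -
    have [measurable]: "A n \<in> sets (\<Pi>\<^sub>M i\<in>{..<n}. borel)" "B n \<in> sets (\<Pi>\<^sub>M i\<in>{..<n}. borel)"
      by (rule open_power_measurable[OF AB(3)], rule open_power_measurable[OF AB(4)])
    show ?thesis unfolding \<phi>_def by measurable
  qed
  then have "is_test \<phi>" unfolding is_test_def by blast
  moreover have "finite_precision \<phi>" unfolding finite_precision_def by (simp add: v0 v1 AB(3,4))
  ultimately show ?thesis
    unfolding converges_to_verdict_def using AB(6,7) by (intro exI[of _ \<phi>]) (simp add: v0 v1)
qed

text \<open>\<open>V\<close> is the trace of a weakly open set \<open>W\<close> that misses \<open>H1\<close>. A neighbourhood \<open>N\<close> of a point of \<open>V\<close> that is
  separated from the complement of \<open>W\<close> is separated from all of \<open>H1\<close>, uncountable as \<open>N\<close> may be; only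
  the dense sets have to be countable.\<close>
lemma dense_subsets_separated_with_open_part:
  fixes H0 H1 :: "'a::{metric_space, second_countable_topology} measure set"
  assumes H: "H0 \<subseteq> borel_probs" "H1 \<subseteq> borel_probs" "H0 \<inter> H1 = {}"
    and V: "openin (ambient_space H0 H1) V" "V \<noteq> {}" "V \<inter> H1 = {}"
  shows "\<exists>D0 D1 G. dense_in (subtopology weak_topology H0) D0 \<and>
    dense_in (subtopology weak_topology H1) D1 \<and> openin (ambient_space H0 H1) G \<and> G \<noteq> {} \<and> G \<subseteq> H0 \<and>
    asymptotically_separated (D0 \<union> G) D1"
proof -
  obtain D0 where D0: "countable D0" "dense_in (subtopology weak_topology H0) D0"
    using weak_topology_hereditarily_separable[OF H(1)] by blast
  obtain D1 where D1: "countable D1" "dense_in (subtopology weak_topology H1) D1"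
    using weak_topology_hereditarily_separable[OF H(2)] by blast
  have sub: "D0 \<subseteq> H0" "D1 \<subseteq> H1" using D0(2) D1(2) unfolding dense_in_def by auto
  obtain W where W: "openin weak_topology W" "V = W \<inter> (H0 \<union> H1)"
    using V(1) unfolding ambient_space_def openin_subtopology by blast
  obtain P where P: "P \<in> V" using V(2) by blast
  obtain N where N: "openin weak_topology N" "P \<in> N" "asymptotically_separated N (borel_probs - W)"
    using asymptotically_separated_nhd[OF W(1), of P] P W(2) by blast
  \<comment> \<open>Intersecting with \<open>W\<close> keeps \<open>G\<close> inside \<open>V\<close> and hence inside \<open>H0\<close>.\<close>
  define G where "G = (N \<inter> W) \<inter> (H0 \<union> H1)"
  have "openin (ambient_space H0 H1) G"
    unfolding G_def ambient_space_def openin_subtopology using N(1) W(1) openin_Int by blast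
  moreover have "G \<noteq> {}" using P N(2) W(2) unfolding G_def by blast
  moreover have "G \<subseteq> H0" using V(3) W(2) unfolding G_def by blast
  moreover have "asymptotically_separated (D0 \<union> G) D1"
  proof (rule asymptotically_separated_Un_left)
    show "asymptotically_separated D0 D1"
      using D0(1) D1(1) sub H by (intro asymptotically_separated_countable) blast+
    have "D1 \<subseteq> borel_probs - W" using sub(2) H(2) V(3) W(2) by blast
    then show "asymptotically_separated G D1"
      by (rule asymptotically_separated_mono[OF N(3), rotated]) (auto simp: G_def)
  qed
  ultimately show ?thesis using D0(2) D1(2) by blast
qed

lemma separated_imp_good_test:
  fixes H0 H1 :: "'a::{metric_space, second_countable_topology} measure set"
  assumes Baire: "Baire_space (ambient_space H0 H1)"
    and D: "dense_in (subtopology weak_topology H0) D0" "dense_in (subtopology weak_topology H1) D1"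
    and S: "D0 \<subseteq> S" "S \<subseteq> H0" "D1 \<subseteq> T" "T \<subseteq> H1" "asymptotically_separated S T"
    and G: "openin (ambient_space H0 H1) G" "G \<noteq> {}" "G \<subseteq> S \<union> T"
  shows "\<exists>\<phi>. is_test \<phi> \<and> finite_precision \<phi> \<and>
    densely_consistent_in_each H0 H1 \<phi> \<and> nonmeagerly_consistent H0 H1 \<phi>"
proof -
  obtain \<phi> where \<phi>: "is_test \<phi>" "finite_precision \<phi>"
    "\<And>P. P \<in> S \<Longrightarrow> converges_to_verdict \<phi> Accept0 P" "\<And>P. P \<in> T \<Longrightarrow> converges_to_verdict \<phi> Accept1 P"
    using asymptotically_separated_imp_test[OF S(5)] by blast
  have cons: "S \<union> T \<subseteq> consistency_set H0 H1 \<phi>"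
    unfolding consistency_set_def using \<phi>(3,4) S(2,4) by blast
  have "densely_consistent_in_each H0 H1 \<phi>"
    unfolding densely_consistent_in_each_def using D S(1,3) cons by blast
  moreover have "nonmeagerly_consistent H0 H1 \<phi>"
    unfolding nonmeagerly_consistent_def
    using meager_in_subset Baire_space_open_not_meager[OF Baire G(1,2)] G(3) cons by blast
  ultimately show ?thesis using \<phi>(1,2) by blast
qed

text \<open>Where one hypothesis fails to be dense there is a nonempty open set disjoint from it; if that
  hypothesis is \<open>H0\<close>, the construction applies with the roles of the hypotheses exchanged.\<close>
lemma not_intertwined_imp_good_test:
  fixes H0 H1 :: "'a::{metric_space, second_countable_topology} measure set"
  assumes H: "hypothesis H0" "hypothesis H1" "H0 \<inter> H1 = {}"
    and Baire: "Baire_space (ambient_space H0 H1)"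
    and ne: "\<not> everywhere_intertwined H0 H1"
  shows "\<exists>\<phi>. is_test \<phi> \<and> finite_precision \<phi> \<and>
    densely_consistent_in_each H0 H1 \<phi> \<and> nonmeagerly_consistent H0 H1 \<phi>"
proof -
  let ?A = "ambient_space H0 H1"
  have sub: "H0 \<subseteq> borel_probs" "H1 \<subseteq> borel_probs" using H(1,2) unfolding hypothesis_def by auto
  have avoid: "\<exists>V. openin ?A V \<and> V \<noteq> {} \<and> V \<inter> H = {}"
    if U: "openin ?A U" and not_dense: "\<not> dense_in (subtopology ?A U) (H \<inter> U)" for H U
  proof -
    have "U \<subseteq> topspace ?A" using openin_subset[OF U] .
    then have "H \<inter> U \<subseteq> topspace (subtopology ?A U)" by auto
    then obtain V where V: "openin (subtopology ?A U) V" "V \<noteq> {}" "(H \<inter> U) \<inter> V = {}"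
      using not_dense unfolding dense_in_iff_Int_open by blast
    then have "openin ?A V" "V \<subseteq> U" using openin_open_subtopology[OF U] by auto
    then show ?thesis using V by blast
  qed
  obtain U where "openin ?A U" "\<not> intertwined_in H0 H1 U"
    using ne unfolding everywhere_intertwined_def by blast
  then consider V where "openin ?A V" "V \<noteq> {}" "V \<inter> H1 = {}" | V where "openin ?A V" "V \<noteq> {}" "V \<inter> H0 = {}"
    unfolding intertwined_in_def using avoid[of U H0] avoid[of U H1] by blast
  then show ?thesis
  proof cases
    case 1
    then obtain D0 D1 G where D: "dense_in (subtopology weak_topology H0) D0"
      "dense_in (subtopology weak_topology H1) D1" and G: "openin ?A G" "G \<noteq> {}" "G \<subseteq> H0"
      and sep: "asymptotically_separated (D0 \<union> G) D1"
      using dense_subsets_separated_with_open_part[OF sub H(3)] by blast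
    have "D0 \<subseteq> H0" "D1 \<subseteq> H1" using D unfolding dense_in_def by auto
    then show ?thesis
      using G by (intro separated_imp_good_test[OF Baire D _ _ _ _ sep G(1,2)]) auto
  next
    case 2
    have comm: "ambient_space H1 H0 = ?A" "H1 \<inter> H0 = {}"
      using H(3) by (auto simp: ambient_space_def Un_commute)
    obtain D0 D1 G where D: "dense_in (subtopology weak_topology H0) D0"
      "dense_in (subtopology weak_topology H1) D1" and G: "openin ?A G" "G \<noteq> {}" "G \<subseteq> H1"
      and sep: "asymptotically_separated (D1 \<union> G) D0"
      using dense_subsets_separated_with_open_part[OF sub(2,1) comm(2), unfolded comm(1), OF 2] by blast
    have "D0 \<subseteq> H0" "D1 \<subseteq> H1" using D unfolding dense_in_def by auto
    then show ?thesis
      using G by (intro separated_imp_good_test[OF Baire D _ _ _ _ asymptotically_separated_sym[OF sep] G(1,2)]) auto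
  qed
qed

section \<open>Meagerness when the hypotheses are intertwined\<close>

text \<open>The sets \<open>U v N\<close> of measures that give the verdict \<open>v\<close> probability above one half at some sample size
  beyond \<open>N\<close> are open by lower semicontinuity and dense by dense consistency. A measure in all of
  them gives both verdicts probability above one half infinitely often, which excludes consistency
  for either verdict.\<close>
lemma intertwined_imp_consistency_set_meager:
  fixes H0 H1 :: "'a::{metric_space, second_countable_topology} measure set"
  assumes H: "hypothesis H0" "hypothesis H1" "H0 \<inter> H1 = {}"
    and intertwined: "everywhere_intertwined H0 H1"
    and test: "finite_precision \<phi>" and dense: "densely_consistent_in_each H0 H1 \<phi>"
  shows "meager_in (ambient_space H0 H1) (consistency_set H0 H1 \<phi>)"
proof -
  let ?A = "ambient_space H0 H1"
  have sub: "H0 \<union> H1 \<subseteq> borel_probs" using H(1,2) unfolding hypothesis_def by auto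
  have top: "topspace ?A = H0 \<union> H1" using sub unfolding ambient_space_def by auto
  define likely where "likely v n = {P \<in> borel_probs. measure (power_measure P n) (verdict_set \<phi> n v) > 1 / 2}"
    for v n
  \<comment> \<open>Starting at \<open>Suc N\<close> avoids the sample size 0, at which the acceptance regions are arbitrary.\<close>
  define U where "U v N = (H0 \<union> H1) \<inter> (\<Union>n\<in>{Suc N..}. likely v n)" for v and N :: nat
  have open_verdict: "openin (power_top n) (verdict_set \<phi> n v)" if "v \<in> {Accept0, Accept1}" "n \<ge> 1" for v n
    using test that unfolding finite_precision_def by blast
  have openU: "openin ?A (U v N)" if v: "v \<in> {Accept0, Accept1}" for v N
  proof -
    have "openin weak_topology (likely v n)" if "n \<in> {Suc N..}" for n
      unfolding likely_def using open_verdict[OF v] that by (intro openin_weak_power_measure_greater) simp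
    then have "openin weak_topology (\<Union>n\<in>{Suc N..}. likely v n)" by (intro openin_Union) blast
    then show ?thesis unfolding U_def ambient_space_def openin_subtopology by blast
  qed
  have in_U: "P \<in> U v N" if "P \<in> H0 \<union> H1" "converges_to_verdict \<phi> v P" for P v N
  proof -
    have "\<forall>\<^sub>F n in sequentially. measure (power_measure P n) (verdict_set \<phi> n v) > 1 / 2"
      using that(2) unfolding converges_to_verdict_def by (rule order_tendstoD) simp
    then obtain n where "n \<ge> Suc N" "measure (power_measure P n) (verdict_set \<phi> n v) > 1 / 2"
      unfolding eventually_sequentially by (meson nat_le_linear)
    then show ?thesis using that(1) sub unfolding U_def likely_def by auto
  qed
  have denseU: "dense_in ?A (U v N)"
    if D: "dense_in (subtopology weak_topology H) D" "\<And>P. P \<in> D \<Longrightarrow> converges_to_verdict \<phi> v P"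
      and Hsub: "H \<subseteq> H0 \<union> H1" and Hdense: "\<And>T. openin ?A T \<Longrightarrow> T \<noteq> {} \<Longrightarrow> H \<inter> T \<noteq> {}" for H D v N
    unfolding dense_in_iff_Int_open
  proof (intro conjI allI impI)
    show "U v N \<subseteq> topspace ?A" unfolding top U_def by blast
    fix T assume T: "openin ?A T \<and> T \<noteq> {}"
    then obtain W where W: "openin weak_topology W" "T = W \<inter> (H0 \<union> H1)"
      unfolding ambient_space_def openin_subtopology by blast
    have "openin (subtopology weak_topology H) (W \<inter> H)" using W(1) unfolding openin_subtopology by blast
    moreover have "W \<inter> H \<noteq> {}" using Hdense[of T] T W(2) Hsub by blast
    ultimately obtain P where P: "P \<in> D" "P \<in> W \<inter> H" using D(1) unfolding dense_in_iff_Int_open by blast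
    then have "P \<in> U v N" using D(2) Hsub by (intro in_U) auto
    then show "U v N \<inter> T \<noteq> {}" using P(2) W(2) Hsub by blast
  qed
  have Hdense: "H0 \<inter> T \<noteq> {}" "H1 \<inter> T \<noteq> {}" if T: "openin ?A T" "T \<noteq> {}" for T
  proof -
    have "intertwined_in H0 H1 T" using intertwined T unfolding everywhere_intertwined_def by blast
    moreover have "openin (subtopology ?A T) T" using T(1) by (simp add: openin_open_subtopology)
    ultimately show "H0 \<inter> T \<noteq> {}" "H1 \<inter> T \<noteq> {}"
      using T(2) unfolding intertwined_in_def dense_in_iff_Int_open by blast+
  qed
  obtain D0 where D0: "dense_in (subtopology weak_topology H0) D0" "D0 \<subseteq> consistency_set H0 H1 \<phi>"
    using dense unfolding densely_consistent_in_each_def by blast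
  obtain D1 where D1: "dense_in (subtopology weak_topology H1) D1" "D1 \<subseteq> consistency_set H0 H1 \<phi>"
    using dense unfolding densely_consistent_in_each_def by blast
  have "D0 \<subseteq> H0" "D1 \<subseteq> H1" using D0(1) D1(1) unfolding dense_in_def by auto
  then have conv: "\<And>P. P \<in> D0 \<Longrightarrow> converges_to_verdict \<phi> Accept0 P" "\<And>P. P \<in> D1 \<Longrightarrow> converges_to_verdict \<phi> Accept1 P"
    using D0(2) D1(2) H(3) unfolding consistency_set_def by blast+
  define \<F> where "\<F> = (\<lambda>(v, N). topspace ?A - U v N) ` ({Accept0, Accept1} \<times> UNIV)"
  have nwd: "nowhere_dense_in ?A F" if FF: "F \<in> \<F>" for F
  proof -
    obtain v N where v: "v \<in> {Accept0, Accept1}" and F: "F = topspace ?A - U v N"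
      using FF unfolding \<F>_def by auto
    have "dense_in ?A (U v N)"
      using v denseU[OF D0(1) conv(1) _ Hdense(1)] denseU[OF D1(1) conv(2) _ Hdense(2)] by auto
    then show ?thesis unfolding F using openU[OF v] by (intro nowhere_dense_in_compl_open_dense)
  qed
  have ex: "\<exists>N. P \<notin> U w N"
    if P: "P \<in> borel_probs" and v: "v \<in> {Accept0, Accept1}" and w: "w \<in> {Accept0, Accept1}"
      and vw: "v \<noteq> w" and conv: "converges_to_verdict \<phi> v P" for P v w
  proof -
    have "\<forall>\<^sub>F n in sequentially. measure (power_measure P n) (verdict_set \<phi> n v) > 1 / 2"
      using conv unfolding converges_to_verdict_def by (rule order_tendstoD) simp
    then obtain N where N: "\<And>n. n \<ge> N \<Longrightarrow> measure (power_measure P n) (verdict_set \<phi> n v) > 1 / 2"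
      unfolding eventually_sequentially by blast
    have "P \<notin> likely w n" if n: "n \<in> {Suc N..}" for n
    proof
      assume "P \<in> likely w n"
      then have w2: "measure (power_measure P n) (verdict_set \<phi> n w) > 1 / 2" unfolding likely_def by blast
      interpret prob_space "power_measure P n" using P by (rule prob_space_power_measure)
      have "verdict_set \<phi> n u \<in> events" if "u \<in> {Accept0, Accept1}" for u
        unfolding sets_power_measure[OF P] using n by (intro open_power_measurable open_verdict[OF that]) simp
      moreover have "verdict_set \<phi> n v \<inter> verdict_set \<phi> n w = {}" using vw unfolding verdict_set_def by blast
      ultimately have "prob (verdict_set \<phi> n v \<union> verdict_set \<phi> n w) =
          prob (verdict_set \<phi> n v) + prob (verdict_set \<phi> n w)"
        using v w by (intro finite_measure_Union) blast+
      then have "prob (verdict_set \<phi> n v) + prob (verdict_set \<phi> n w) \<le> 1" using prob_le_1 by metis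
      moreover have "prob (verdict_set \<phi> n v) > 1 / 2" using n by (intro N) simp
      ultimately show False using w2 by linarith
    qed
    then show ?thesis unfolding U_def by blast
  qed
  have "consistency_set H0 H1 \<phi> \<subseteq> \<Union>\<F>"
  proof
    fix P assume "P \<in> consistency_set H0 H1 \<phi>"
    then obtain v w where P: "P \<in> H0 \<union> H1" and vw: "v \<in> {Accept0, Accept1}" "w \<in> {Accept0, Accept1}"
      "v \<noteq> w" "converges_to_verdict \<phi> v P"
      unfolding consistency_set_def by blast
    then obtain N where "P \<notin> U w N" using ex sub by blast
    then have "P \<in> topspace ?A - U w N" using P top by blast
    moreover have "topspace ?A - U w N \<in> \<F>" unfolding \<F>_def using vw(2) by force
    ultimately show "P \<in> \<Union>\<F>" by blast
  qed
  moreover have "meager_in ?A (\<Union>\<F>)"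
  proof -
    have "countable \<F>" unfolding \<F>_def by (intro countable_image countable_SIGMA) auto
    then show ?thesis unfolding meager_in_def using nwd by blast
  qed
  ultimately show ?thesis by (rule meager_in_subset[rotated])
qed


theorem theorem3:
  fixes H0 H1 :: "'a::polish_space measure set"
  assumes "hypothesis H0" and "hypothesis H1" and "H0 \<inter> H1 = {}"
    and "Baire_space (ambient_space H0 H1)"
  shows "everywhere_intertwined H0 H1 \<longleftrightarrow>
    (\<nexists>\<phi>. is_test \<phi> \<and> finite_precision \<phi> \<and>
       densely_consistent_in_each H0 H1 \<phi> \<and> nonmeagerly_consistent H0 H1 \<phi>)"
  using intertwined_imp_consistency_set_meager[OF assms(1-3)] not_intertwined_imp_good_test[OF assms]
  unfolding nonmeagerly_consistent_def by blast

end
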